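(* Every element of $\mathrm{PSp}(n,1)$ is a product of two involutions of $\mathrm{PSp}(n,1)$.
   Context: Let $\mathbb{H}$ be the real quaternions and $n\ge1$. $\mathrm{Sp}(n,1)=\{g\in \mathrm{GL}(n+1,\mathbb{H})\mid {}^{t}\bar g J g=J\}$ with $J=\mathrm{diag}(-1,1,\ldots,1)$. Its center is $\{\pm I_{n+1}\}$, and $\mathrm{PSp}(n,1)=\mathrm{Sp}(n,1)/\{\pm I_{n+1}\}$. An involution in a group is a non-trivial element $g$ with $g^2=1$. *)

theory Defs
  imports Complex_Main "HOL-Algebra.Coset" "Jordan_Normal_Form.Matrix"
begin

(* Quat a b c d stands for the real quaternion a + b i + c j + d k. *)
datatype quat = Quat (q_re: real) (q_i: real) (q_j: real) (q_k: real)

lemma quat_eq_iff: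
  "x = y \<longleftrightarrow> q_re x = q_re y \<and> q_i x = q_i y \<and> q_j x = q_j y \<and> q_k x = q_k y"
  by (cases x; cases y) simp

(* The product is the Hamilton product: i^2 = j^2 = k^2 = i j k = -1. *)
instantiation quat :: ring_1
begin

definition "0 = Quat 0 0 0 0"
definition "1 = Quat 1 0 0 0"
definition "x + y = Quat (q_re x + q_re y) (q_i x + q_i y) (q_j x + q_j y) (q_k x + q_k y)"
definition "- x = Quat (- q_re x) (- q_i x) (- q_j x) (- q_k x)"
definition "x - y = Quat (q_re x - q_re y) (q_i x - q_i y) (q_j x - q_j y) (q_k x - q_k y)"
definition "x * y = Quat
  (q_re x * q_re y - q_i x * q_i y - q_j x * q_j y - q_k x * q_k y)
  (q_re x * q_i y + q_i x * q_re y + q_j x * q_k y - q_k x * q_j y)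
  (q_re x * q_j y - q_i x * q_k y + q_j x * q_re y + q_k x * q_i y)
  (q_re x * q_k y + q_i x * q_j y - q_j x * q_i y + q_k x * q_re y)"

lemmas quat_ring_defs =
  zero_quat_def one_quat_def plus_quat_def uminus_quat_def minus_quat_def times_quat_def

instance
  by standard (auto simp: quat_ring_defs quat_eq_iff algebra_simps)

end

definition q_cnj :: "quat \<Rightarrow> quat" where
  "q_cnj x = Quat (q_re x) (- q_i x) (- q_j x) (- q_k x)"

definition q_norm2 :: "quat \<Rightarrow> real" where
  "q_norm2 x = (q_re x)\<^sup>2 + (q_i x)\<^sup>2 + (q_j x)\<^sup>2 + (q_k x)\<^sup>2"

lemma q_norm2_nonzero: "x \<noteq> 0 \<Longrightarrow> q_norm2 x \<noteq> 0"
  unfolding q_norm2_def quat_eq_iff zero_quat_def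
  by (auto simp: add_nonneg_eq_0_iff)

instantiation quat :: division_ring
begin

definition "inverse x = Quat (q_re x / q_norm2 x) (- q_i x / q_norm2 x)
  (- q_j x / q_norm2 x) (- q_k x / q_norm2 x)"
definition "x div y = x * inverse y" for x y :: quat

instance
proof
  fix x y :: quat
  assume "x \<noteq> 0"
  then have *: "q_norm2 x \<noteq> 0"
    by (rule q_norm2_nonzero)
  then have **: "q_re x * q_re x / q_norm2 x + q_i x * q_i x / q_norm2 x
      + q_j x * q_j x / q_norm2 x + q_k x * q_k x / q_norm2 x = 1"
    by (simp add: q_norm2_def power2_eq_square flip: add_divide_distrib)
  show "inverse x * x = 1" "x * inverse x = 1"
    using ** by (simp_all add: inverse_quat_def times_quat_def one_quat_def mult.commute)
next
  show "x div y = x * inverse y" for x y :: quat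
    by (rule divide_quat_def)
next
  show "inverse (0 :: quat) = 0"
    by (simp add: inverse_quat_def zero_quat_def)
qed

end

lemma q_cnj_simps [simp]:
  "q_cnj 0 = 0" "q_cnj 1 = 1" "q_cnj (q_cnj x) = x" "q_cnj (- x) = - q_cnj x"
  "q_cnj (x + y) = q_cnj x + q_cnj y" "q_cnj (x * y) = q_cnj y * q_cnj x"
  by (auto simp: q_cnj_def quat_ring_defs algebra_simps)

lemma q_cnj_sum: "q_cnj (sum f A) = (\<Sum>a\<in>A. q_cnj (f a))"
  by (induction A rule: infinite_finite_induct) auto

definition q_adjoint :: "quat mat \<Rightarrow> quat mat" where
  "q_adjoint A = transpose_mat (map_mat q_cnj A)"

lemma q_adjoint_carrier [simp]:
  "A \<in> carrier_mat m n \<Longrightarrow> q_adjoint A \<in> carrier_mat n m"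
  by (simp add: q_adjoint_def)

lemma q_adjoint_mult:
  assumes "A \<in> carrier_mat m n" "B \<in> carrier_mat n p"
  shows "q_adjoint (A * B) = q_adjoint B * q_adjoint A"
  using assms
  by (intro eq_matI) (auto simp: q_adjoint_def scalar_prod_def q_cnj_sum intro!: sum.cong)

lemma q_adjoint_one [simp]: "q_adjoint (1\<^sub>m n) = 1\<^sub>m n"
  by (intro eq_matI) (auto simp: q_adjoint_def)

lemma q_adjoint_uminus: "q_adjoint (- A) = - q_adjoint A"
  by (intro eq_matI) (auto simp: q_adjoint_def)

definition J_mat :: "nat \<Rightarrow> quat mat" where
  "J_mat n = mat_diag (n + 1) (\<lambda>i. if i = 0 then - 1 else 1)"

lemma J_mat_carrier [simp]: "J_mat n \<in> carrier_mat (n + 1) (n + 1)"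
  by (simp add: J_mat_def)

definition Sp :: "nat \<Rightarrow> quat mat monoid" where
  "Sp n = \<lparr> carrier = {g \<in> carrier_mat (n + 1) (n + 1).
              invertible_mat g \<and> q_adjoint g * J_mat n * g = J_mat n},
            monoid.mult = (*), one = 1\<^sub>m (n + 1) \<rparr>"

definition PSp :: "nat \<Rightarrow> quat mat set monoid" where
  "PSp n = Sp n Mod {1\<^sub>m (n + 1), - 1\<^sub>m (n + 1)}"

definition involution_in :: "('a, 'b) monoid_scheme \<Rightarrow> 'a \<Rightarrow> bool" where
  "involution_in G g \<longleftrightarrow> g \<in> carrier G \<and> g \<noteq> \<one>\<^bsub>G\<^esub> \<and> g \<otimes>\<^bsub>G\<^esub> g = \<one>\<^bsub>G\<^esub>"

lemma Sp_carrier_iff: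
  "g \<in> carrier (Sp n) \<longleftrightarrow> g \<in> carrier_mat (n + 1) (n + 1) \<and>
     (\<exists>h \<in> carrier_mat (n + 1) (n + 1). g * h = 1\<^sub>m (n + 1) \<and> h * g = 1\<^sub>m (n + 1)) \<and>
     q_adjoint g * J_mat n * g = J_mat n"
proof -
  have "invertible_mat g \<longleftrightarrow>
      (\<exists>h \<in> carrier_mat (n + 1) (n + 1). g * h = 1\<^sub>m (n + 1) \<and> h * g = 1\<^sub>m (n + 1))"
    if g: "g \<in> carrier_mat (n + 1) (n + 1)"
  proof
    assume "invertible_mat g"
    then obtain h where h: "g * h = 1\<^sub>m (n + 1)" "h * g = 1\<^sub>m (dim_row h)"
      using g by (auto simp: invertible_mat_def inverts_mat_def)
    have "dim_col h = n + 1" "dim_row h = n + 1"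
      using arg_cong[OF h(1), of dim_col] arg_cong[OF h(2), of dim_col] g by auto
    with h show "\<exists>h \<in> carrier_mat (n + 1) (n + 1). g * h = 1\<^sub>m (n + 1) \<and> h * g = 1\<^sub>m (n + 1)"
      by (intro bexI[of _ h]) auto
  next
    assume "\<exists>h \<in> carrier_mat (n + 1) (n + 1). g * h = 1\<^sub>m (n + 1) \<and> h * g = 1\<^sub>m (n + 1)"
    then show "invertible_mat g"
      using g by (auto simp: invertible_mat_def inverts_mat_def)
  qed
  then show ?thesis
    by (auto simp: Sp_def)
qed

lemma Sp_mult [simp]: "x \<otimes>\<^bsub>Sp n\<^esub> y = x * y"
  and Sp_one [simp]: "\<one>\<^bsub>Sp n\<^esub> = 1\<^sub>m (n + 1)"
  by (simp_all add: Sp_def)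

lemma group_Sp: "group (Sp n)"
proof (rule groupI)
  let ?C = "carrier_mat (n + 1) (n + 1) :: quat mat set" and ?I = "1\<^sub>m (n + 1) :: quat mat"
  have J: "J_mat n \<in> ?C"
    by (rule J_mat_carrier)
  fix x assume x: "x \<in> carrier (Sp n)"
  then have xC: "x \<in> ?C" and xJ: "q_adjoint x * J_mat n * x = J_mat n"
    by (auto simp: Sp_carrier_iff)
  from x obtain x' where x': "x' \<in> ?C" "x * x' = ?I" "x' * x = ?I"
    by (auto simp: Sp_carrier_iff)
  note aC = q_adjoint_carrier[OF xC] and a'C = q_adjoint_carrier[OF x'(1)]
  show "\<exists>y\<in>carrier (Sp n). y \<otimes>\<^bsub>Sp n\<^esub> x = \<one>\<^bsub>Sp n\<^esub>"
  proof (rule bexI[of _ x'])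
    have "q_adjoint x' * J_mat n * x' = q_adjoint x' * (q_adjoint x * J_mat n * x) * x'"
      by (simp only: xJ)
    also have "\<dots> = (q_adjoint x' * q_adjoint x) * J_mat n * (x * x')"
      using xC x'(1) J aC a'C
      by (simp add: assoc_mult_mat[of _ "n+1" "n+1" _ "n+1" _ "n+1"]
          mult_carrier_mat[of _ "n+1" "n+1" _ "n+1"] del: One_nat_def)
    also have "q_adjoint x' * q_adjoint x = ?I"
      using q_adjoint_mult[OF xC x'(1)] x' by simp
    finally have "q_adjoint x' * J_mat n * x' = J_mat n"
      using J x' by simp
    then show "x' \<in> carrier (Sp n)"
      using xC x' by (auto simp: Sp_carrier_iff)
    show "x' \<otimes>\<^bsub>Sp n\<^esub> x = \<one>\<^bsub>Sp n\<^esub>"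
      using x' by simp
  qed
  show "\<one>\<^bsub>Sp n\<^esub> \<otimes>\<^bsub>Sp n\<^esub> x = x"
    using xC by simp
  fix y assume y: "y \<in> carrier (Sp n)"
  then have yC: "y \<in> ?C" and yJ: "q_adjoint y * J_mat n * y = J_mat n"
    by (auto simp: Sp_carrier_iff)
  from y obtain y' where y': "y' \<in> ?C" "y * y' = ?I" "y' * y = ?I"
    by (auto simp: Sp_carrier_iff)
  note bC = q_adjoint_carrier[OF yC]
  show "x \<otimes>\<^bsub>Sp n\<^esub> y \<in> carrier (Sp n)"
  proof -
    have "q_adjoint (x * y) * J_mat n * (x * y)
        = q_adjoint y * (q_adjoint x * J_mat n * x) * y"
      unfolding q_adjoint_mult[OF xC yC] using xC yC J aC bC
      by (simp add: assoc_mult_mat[of _ "n+1" "n+1" _ "n+1" _ "n+1"]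
          mult_carrier_mat[of _ "n+1" "n+1" _ "n+1"] del: One_nat_def)
    then have *: "q_adjoint (x * y) * J_mat n * (x * y) = J_mat n"
      by (simp only: xJ yJ)
    have "x * y * (y' * x') = x * (y * y') * x'" "y' * x' * (x * y) = y' * (x' * x) * y"
      using xC yC x'(1) y'(1)
      by (simp_all add: assoc_mult_mat[of _ "n+1" "n+1" _ "n+1" _ "n+1"]
          mult_carrier_mat[of _ "n+1" "n+1" _ "n+1"] del: One_nat_def)
    then have "x * y * (y' * x') = ?I" "y' * x' * (x * y) = ?I"
      using xC yC x' y' by simp_all
    then show ?thesis
      using * xC yC x'(1) y'(1)
      by (auto simp: Sp_carrier_iff simp del: One_nat_def assoc_mult_mat
          intro!: bexI[of _ "y' * x'"])
  qed
  fix z assume "z \<in> carrier (Sp n)"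
  then show "x \<otimes>\<^bsub>Sp n\<^esub> y \<otimes>\<^bsub>Sp n\<^esub> z = x \<otimes>\<^bsub>Sp n\<^esub> (y \<otimes>\<^bsub>Sp n\<^esub> z)"
    using xC yC by (simp add: Sp_carrier_iff assoc_mult_mat[of _ "n+1" "n+1" _ "n+1" _ "n+1"])
next
  show "\<one>\<^bsub>Sp n\<^esub> \<in> carrier (Sp n)"
    by (auto simp: Sp_carrier_iff left_mult_one_mat[OF J_mat_carrier[of n], simplified]
        right_mult_one_mat[OF J_mat_carrier[of n], simplified] intro!: bexI[of _ "1\<^sub>m (n + 1)"])
qed

lemma normal_pm_one_Sp: "{1\<^sub>m (n + 1), - 1\<^sub>m (n + 1)} \<lhd> Sp n"
proof -
  interpret group "Sp n"
    by (rule group_Sp)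
  let ?I = "1\<^sub>m (n + 1) :: quat mat"
  have 1: "?I \<in> carrier (Sp n)"
    using one_closed by simp
  have mm: "- ?I * - ?I = ?I"
    by (simp add: uminus_mult_left_mat uminus_mult_right_mat)
  have "- ?I * J_mat n * - ?I = J_mat n"
    using J_mat_carrier[of n] by auto
  then have m1: "- ?I \<in> carrier (Sp n)"
    using mm by (auto simp: Sp_carrier_iff q_adjoint_uminus intro!: bexI[of _ "- ?I"])
  have "subgroup {?I, - ?I} (Sp n)"
  proof (rule subgroupI)
    show "{?I, - ?I} \<subseteq> carrier (Sp n)" "{?I, - ?I} \<noteq> {}"
      using 1 m1 by auto
    have "inv\<^bsub>Sp n\<^esub> ?I = ?I" "inv\<^bsub>Sp n\<^esub> (- ?I) = - ?I"
      using inv_equality[of ?I ?I] inv_equality[of "- ?I" "- ?I"] 1 m1 mm by simp_all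
    then show "inv\<^bsub>Sp n\<^esub> a \<in> {?I, - ?I}" if "a \<in> {?I, - ?I}" for a
      using that by auto
    show "a \<otimes>\<^bsub>Sp n\<^esub> b \<in> {?I, - ?I}" if "a \<in> {?I, - ?I}" "b \<in> {?I, - ?I}" for a b
      using that mm by auto
  qed
  then show ?thesis
  proof (rule normalI, intro ballI)
    fix x assume "x \<in> carrier (Sp n)"
    then have "x * ?I = ?I * x" "x * - ?I = - ?I * x"
      by (auto simp: Sp_carrier_iff)
    then show "{?I, - ?I} #>\<^bsub>Sp n\<^esub> x = x <#\<^bsub>Sp n\<^esub> {?I, - ?I}"
      by (auto simp: r_coset_def l_coset_def)
  qed
qed

lemma group_PSp: "group (PSp n)"
  unfolding PSp_def by (rule normal.factorgroup_is_group[OF normal_pm_one_Sp])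

end

theory Submission
  imports Defs "Jordan_Normal_Form.Determinant" "HOL-Library.Function_Algebras"
    "HOL-Computational_Algebra.Fundamental_Theorem_Algebra"
begin

text \<open>Every \<open>g\<close> in Sp(n,1) is conjugated to its inverse by some \<open>a\<close> in Sp(n,1) with \<open>a\<^sup>2 = -1\<close>;
  then also \<open>(a g)\<^sup>2 = -1\<close>, and \<open>g\<close> is up to sign the product of \<open>a\<close> and \<open>a g\<close>.
  To find \<open>a\<close>, nondegenerate \<open>g\<close>-invariant subspaces \<open>U\<close> are split off one after the other, starting
  from an eigenvector \<open>v\<close> with eigenvalue \<open>l\<close>. If there is a non-null \<open>v\<close>, let \<open>U\<close> be its span. If all
  eigenvectors are null and \<open>l\<close> is not a unit, \<open>v\<close> and a second eigenvector, with eigenvalue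
  \<open>1 / q_cnj l\<close>, span \<open>U\<close>. If all are null and \<open>l\<close> is a unit, the whole remaining space has dimension
  2 or 3 and \<open>g\<close> acts on it by a Jordan block. In each case \<open>a\<close> is given by an imaginary unit \<open>p\<close>
  with \<open>p l = (q_cnj l) p\<close>, combined with a permutation or sign change of a basis.\<close>

section \<open>Quaternions as pairs of complex numbers\<close>

text \<open>\<open>Qz a b\<close> is the quaternion \<open>a + j b\<close>; as \<open>b j = j (cnj b)\<close>, right multiplication by a complex
  number acts on both coordinates by ordinary multiplication.\<close>
definition Qz :: "complex \<Rightarrow> complex \<Rightarrow> quat" where
  "Qz a b = Quat (Re a) (Im a) (Re b) (- Im b)"

abbreviation q_complex :: "complex \<Rightarrow> quat" where
  "q_complex z \<equiv> Qz z 0"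

abbreviation q_real :: "real \<Rightarrow> quat" where
  "q_real r \<equiv> Qz (complex_of_real r) 0"

lemma Qz_cases: obtains a b where "q = Qz a b"
  by (rule that[of "Complex (q_re q) (q_i q)" "Complex (q_j q) (- q_k q)"]) (simp add: Qz_def)

lemma Qz_eq_iff [simp]: "Qz a b = Qz c d \<longleftrightarrow> a = c \<and> b = d"
  by (auto simp: Qz_def complex_eq_iff)

lemma Qz_0: "0 = Qz 0 0" and Qz_1: "1 = Qz 1 0"
  by (auto simp: Qz_def zero_quat_def one_quat_def)

lemma Qz_eq_0_iff [simp]: "Qz a b = 0 \<longleftrightarrow> a = 0 \<and> b = 0"
  by (simp add: Qz_0)

lemma Qz_eq_1_iff [simp]: "Qz a b = 1 \<longleftrightarrow> a = 1 \<and> b = 0"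
  by (simp add: Qz_1)

lemma Qz_add: "Qz a b + Qz c d = Qz (a + c) (b + d)"
  and Qz_diff: "Qz a b - Qz c d = Qz (a - c) (b - d)"
  and Qz_uminus: "- Qz a b = Qz (- a) (- b)"
  by (auto simp: Qz_def quat_ring_defs)

lemma Qz_mult: "Qz a b * Qz c d = Qz (a * c - cnj b * d) (cnj a * d + b * c)"
  by (auto simp: Qz_def quat_ring_defs algebra_simps)

lemma Qz_cnj: "q_cnj (Qz a b) = Qz (cnj a) (- b)"
  by (auto simp: Qz_def q_cnj_def)

lemma q_norm2_Qz: "q_norm2 (Qz a b) = (cmod a)\<^sup>2 + (cmod b)\<^sup>2"
  by (simp add: q_norm2_def Qz_def cmod_power2)

lemmas Qz_simps = Qz_add Qz_diff Qz_uminus Qz_mult Qz_cnj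

lemma q_cnj_diff [simp]: "q_cnj (x - y) = q_cnj x - q_cnj y"
  by (simp add: q_cnj_def quat_ring_defs)

lemma q_cnj_eq_0_iff [simp]: "q_cnj x = 0 \<longleftrightarrow> x = 0"
  by (metis q_cnj_simps(1,3))

lemma q_real_commute: "q_real r * x = x * q_real r"
  by (cases x rule: Qz_cases) (simp add: Qz_mult)

lemma q_cnj_real [simp]: "q_cnj (q_real r) = q_real r"
  by (simp add: Qz_cnj)

lemma q_cnj_mult_self: "q_cnj x * x = q_real (q_norm2 x)"
  and q_mult_cnj_self: "x * q_cnj x = q_real (q_norm2 x)"
  by (auto simp: q_norm2_def Qz_def q_cnj_def times_quat_def power2_eq_square)

lemma q_norm2_mult: "q_norm2 (x * y) = q_norm2 x * q_norm2 y"
  by (simp add: q_norm2_def times_quat_def power2_eq_square algebra_simps)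

lemma q_norm2_cnj [simp]: "q_norm2 (q_cnj x) = q_norm2 x"
  by (simp add: q_norm2_def q_cnj_def)

lemma q_norm2_eq_0_iff [simp]: "q_norm2 x = 0 \<longleftrightarrow> x = 0"
  using q_norm2_nonzero by (auto simp: q_norm2_def zero_quat_def)

lemma q_norm2_nonneg [simp]: "q_norm2 x \<ge> 0"
  by (simp add: q_norm2_def)

lemma q_real_if_self_cnj: "x = q_real (q_re x)" if "q_cnj x = x"
  using that by (auto simp: q_cnj_def Qz_def quat_eq_iff)

lemma q_re_Qz [simp]: "q_re (Qz a b) = Re a"
  by (simp add: Qz_def)

lemma q_unit_inverse:
  assumes "q_norm2 l = 1"
  shows "inverse l = q_cnj l" "l * q_cnj l = 1" "q_cnj l * l = 1"
  using assms by (simp_all add: q_mult_cnj_self q_cnj_mult_self inverse_unique)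

text \<open>An imaginary unit orthogonal to the imaginary part of \<open>x\<close> anticommutes with
  that part and commutes with the real part. The quarter turn \<open>(- c, b)\<close> of
  \<open>(b, c)\<close>, normalized, gives one in the plane of i and j; if \<open>b\<close> and
  \<open>c\<close> vanish, i itself serves.\<close>

lemma ex_anticommuting_unit:
  obtains p where "p * p = -1" "q_cnj p = - p" "p * x = q_cnj x * p"
proof -
  obtain a b c d where x: "x = Quat a b c d"
    by (cases x)
  show ?thesis
  proof (cases "b = 0 \<and> c = 0")
    case True
    then show ?thesis
      by (intro that[of "Quat 0 1 0 0"]) (simp_all add: x quat_ring_defs q_cnj_def)
  next
    case False
    define r where "r = sqrt (b\<^sup>2 + c\<^sup>2)"
    have r: "r * r = b * b + c * c" "r \<noteq> 0"
      using False by (auto simp: r_def power2_eq_square sum_power2_eq_zero_iff add_nonneg_eq_0_iff)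
    have "c / r * (c / r) + b / r * (b / r) = (b * b + c * c) / (r * r)"
      by (simp add: add_divide_distrib)
    also have "\<dots> = 1"
      unfolding r(1)[symmetric] using r(2) by simp
    finally have "c / r * (c / r) + b / r * (b / r) = 1" "c / r * b = b / r * c"
      by simp_all
    then show ?thesis
      by (intro that[of "Quat 0 (- (c / r)) (b / r) 0"])
        (simp_all add: x quat_ring_defs q_cnj_def algebra_simps del: times_divide_eq_left times_divide_eq_right)
  qed
qed

text \<open>The sum \<open>x + q_cnj x\<close> is real, hence central; cancelling the hypothesis
  from \<open>p * (x + q_cnj x) = (x + q_cnj x) * p\<close> leaves the claim.\<close>

lemma anticommuting_unit_swap: "x * p = p * q_cnj x" if "p * x = q_cnj x * p"
proof -
  have "x + q_cnj x = q_real (2 * q_re x)"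
    by (simp add: q_cnj_def plus_quat_def Qz_def)
  then have "p * (x + q_cnj x) = (x + q_cnj x) * p"
    by (simp only: q_real_commute)
  with that show ?thesis
    by (simp add: distrib_left distrib_right)
qed

lemma cnj_eq_inverse_if_unit: "cnj z * z = 1" if "cmod z = 1"
  using that by (metis complex_norm_square mult.commute of_real_1 one_power2)

text \<open>The rotation \<open>c \<mapsto> l c (q_cnj l)\<close> of the imaginary quaternions fixes the
  axis of \<open>l\<close> and has no fixed vector orthogonal to it, so the orthogonal part of \<open>t\<close>
  can be removed.\<close>
lemma ex_commuting_imaginary:
  assumes l: "cmod l = 1" and t: "q_cnj t = - t"
  obtains c p where "q_cnj c = - c" "p * p = -1" "q_cnj p = - p"
    "p * q_complex l = q_cnj (q_complex l) * p"
    "p * (t + q_complex l * c * q_cnj (q_complex l) - c) =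
      - (t + q_complex l * c * q_cnj (q_complex l) - c) * p"
    "(t + q_complex l * c * q_cnj (q_complex l) - c) * q_complex l =
      q_complex l * (t + q_complex l * c * q_cnj (q_complex l) - c)"
proof (cases "cnj l = l")
  case True
  obtain p where p: "p * p = -1" "q_cnj p = - p" "p * t = q_cnj t * p"
    by (rule ex_anticommuting_unit)
  obtain r where r: "l = complex_of_real r"
    using True by (metis Reals_cnj_iff Reals_cases)
  show ?thesis
    by (rule that[of 0 p]) (use p t in \<open>simp_all add: r q_real_commute\<close>)
next
  case False
  obtain a b where ab: "t = Qz a b"
    by (rule Qz_cases)
  have a: "cnj a = - a"
    using t by (simp add: ab Qz_simps)
  have ll: "cnj l * l = 1"
    using l by (rule cnj_eq_inverse_if_unit)
  have ne: "1 - cnj l * cnj l \<noteq> 0"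
    using False ll by (metis eq_iff_diff_eq_0 mult.assoc mult.right_neutral mult_1)
  \<comment> \<open>Multiplying \<open>Qz 0 c\<close> by \<open>l\<close> on the left and by its
    conjugate on the right scales the second coordinate by \<open>cnj l * cnj l\<close>, which is
    not 1 as \<open>l\<close> is a non-real unit. Hence \<open>b\<close> can be cancelled, and j
    serves as \<open>p\<close> for the complex numbers that remain.\<close>
  define c where "c = b / (1 - cnj l * cnj l)"
  have "b = c * (1 - cnj l * cnj l)"
    using ne by (simp add: c_def)
  then have *: "t + q_complex l * Qz 0 c * q_cnj (q_complex l) - Qz 0 c = q_complex a"
    by (simp add: ab Qz_simps algebra_simps)
  show ?thesis
    by (rule that[of "Qz 0 c" "Qz 0 1"]) (unfold *, simp_all add: Qz_simps Qz_1 a)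
qed

text \<open>If \<open>g x = x m + v \<beta>\<close> and \<open>g v = v l\<close>, then \<open>x' = x \<rho> + v \<gamma>\<close> satisfies \<open>g x' = x' m\<close> (with
  \<open>\<rho> = 1\<close>) in the first case and \<open>g x' = (x' + v) l\<close> in the second.\<close>
lemma jordan_pair_normal_form:
  fixes l m :: complex and \<beta> :: quat
  assumes "cmod l = 1" "cmod m = 1"
  shows "(\<exists>\<gamma>. \<beta> + q_complex l * \<gamma> = \<gamma> * q_complex m) \<or>
    (\<exists>\<rho> \<gamma>. \<rho> \<noteq> 0 \<and> q_complex m * \<rho> = \<rho> * q_complex l \<and>
      \<beta> * \<rho> + q_complex l * \<gamma> = \<gamma> * q_complex l + q_complex l)"
proof -
  obtain b1 b2 where b: "\<beta> = Qz b1 b2"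
    by (rule Qz_cases)
  have l0: "l \<noteq> 0"
    using assms by auto
  \<comment> \<open>With \<open>\<gamma> = Qz c1 c2\<close> the first alternative reads
    \<open>b1 = c1 * (m - l)\<close> and \<open>b2 = c2 * (m - cnj l)\<close>. The second one is
    needed only when a factor vanishes and the matching coordinate of \<open>\<beta>\<close> does
    not.\<close>
  consider "m \<noteq> l" "m \<noteq> cnj l" | "m = l" "cnj l = l" | "m = l" "cnj l \<noteq> l" | "m = cnj l" "cnj l \<noteq> l"
    by blast
  then show ?thesis
  proof cases
    case 1
    have "b1 = (b1 / (m - l)) * (m - l)" "b2 = (b2 / (m - cnj l)) * (m - cnj l)"
      using 1 by auto
    then have "\<beta> + q_complex l * Qz (b1 / (m - l)) (b2 / (m - cnj l)) =
        Qz (b1 / (m - l)) (b2 / (m - cnj l)) * q_complex m"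
      using 1 by (simp add: b Qz_simps divide_simps) (simp add: algebra_simps)
    then show ?thesis
      by blast
  next
    case 2
    have com: "q_complex l * x = x * q_complex l" for x
      using 2 by (cases x rule: Qz_cases) (simp add: Qz_simps)
    show ?thesis
    proof (cases "\<beta> = 0")
      case True
      then show ?thesis
        by (intro disjI1 exI[of _ 0]) simp
    next
      case False
      then show ?thesis
        using 2 l0 com by (intro disjI2 exI[of _ "inverse \<beta> * q_complex l"] exI[of _ 0])
          (simp flip: mult.assoc)
    qed
  next
    case 3
    show ?thesis
    proof (cases "b1 = 0")
      case True
      then show ?thesis
        using 3 by (intro disjI1 exI[of _ "Qz 0 (b2 / (l - cnj l))"])
          (simp add: b Qz_simps divide_simps, simp add: algebra_simps)
    next
      case False
      then show ?thesis
        using 3 l0 by (intro disjI2 exI[of _ "q_complex (l / b1)"]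
            exI[of _ "Qz 0 (b2 * l / b1 / (l - cnj l))"])
          (simp add: b Qz_simps divide_simps, simp add: algebra_simps)
    qed
  next
    case 4
    show ?thesis
    proof (cases "b2 = 0")
      case True
      then show ?thesis
        using 4 by (intro disjI1 exI[of _ "Qz (b1 / (cnj l - l)) 0"])
          (simp add: b Qz_simps divide_simps, simp add: algebra_simps)
    next
      case False
      then show ?thesis
        using 4 l0 by (intro disjI2 exI[of _ "Qz 0 (- l / cnj b2)"]
            exI[of _ "Qz 0 (- cnj b1 * l / cnj b2 / (l - cnj l))"])
          (simp add: b Qz_simps divide_simps, simp add: algebra_simps)
    qed
  qed
qed


section \<open>Isometries of quaternionic Hermitian spaces\<close>

text \<open>Scalars act on the right, so that matrices can act linearly from the left. Finiteness
  and nondegeneracy are later required of individual subspaces only.\<close>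

locale quat_isometry =
  fixes sc :: "'v::ab_group_add \<Rightarrow> quat \<Rightarrow> 'v" (infixl "\<star>" 75)
    and B :: "'v \<Rightarrow> 'v \<Rightarrow> quat" and g g' :: "'v \<Rightarrow> 'v"
  assumes sc_add: "(x + y) \<star> q = x \<star> q + y \<star> q"
    and sc_add_right: "x \<star> (p + q) = x \<star> p + x \<star> q"
    and sc_sc [simp]: "x \<star> p \<star> q = x \<star> (p * q)"
    and sc_1 [simp]: "x \<star> 1 = x"
    and B_add: "B x (y + z) = B x y + B x z"
    and B_sc: "B x (y \<star> q) = B x y * q"
    and B_cnj: "q_cnj (B x y) = B y x"
    and g_add: "g (x + y) = g x + g y"
    and g_sc: "g (x \<star> q) = g x \<star> q"
    and B_g [simp]: "B (g x) (g y) = B x y"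
    and g_g' [simp]: "g (g' x) = x"
    and g'_g [simp]: "g' (g x) = x"
begin

definition lin :: "('v \<Rightarrow> 'v) \<Rightarrow> bool" where
  "lin f \<longleftrightarrow> (\<forall>x y. f (x + y) = f x + f y) \<and> (\<forall>x q. f (x \<star> q) = f x \<star> q)"

lemma sc_0_right [simp]: "x \<star> 0 = 0"
  using sc_add_right[of x 0 0] by simp

lemma sc_minus_right: "x \<star> (- q) = - (x \<star> q)"
  using sc_add_right[of x q "- q"] by (simp add: eq_neg_iff_add_eq_0 add.commute)

lemma sc_0 [simp]: "0 \<star> q = 0"
  using sc_add[of 0 0 q] by simp

lemma sc_diff: "(x - y) \<star> q = x \<star> q - y \<star> q"
  using sc_add[of "x - y" y q] by simp

lemma sc_diff_right: "x \<star> (p - q) = x \<star> p - x \<star> q"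
  using sc_add_right[of x "p - q" q] by simp

lemma sc_eq_0_iff [simp]: "x \<star> q = 0 \<longleftrightarrow> x = 0 \<or> q = 0"
proof
  assume *: "x \<star> q = 0"
  show "x = 0 \<or> q = 0"
  proof (rule disjCI)
    assume "q \<noteq> 0"
    then have "x = x \<star> q \<star> inverse q"
      by simp
    then show "x = 0"
      by (simp only: * sc_0)
  qed
qed auto

lemma B_add_left: "B (x + y) z = B x z + B y z"
  by (metis B_add B_cnj q_cnj_simps(5))

lemma B_sc_left: "B (x \<star> q) y = q_cnj q * B x y"
  by (metis B_sc B_cnj q_cnj_simps(6))

lemma B_0 [simp]: "B x 0 = 0" "B 0 x = 0"
  using B_add[of x 0 0] B_add_left[of 0 0 x] by simp_all

lemma B_diff: "B x (y - z) = B x y - B x z" "B (x - y) z = B x z - B y z"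
  using B_add[of x "y - z" z] B_add_left[of "x - y" y z] by simp_all

lemma lin_0: "lin f \<Longrightarrow> f 0 = 0"
  by (metis lin_def sc_0_right)

lemma lin_minus: "lin f \<Longrightarrow> f (- x) = - f x"
  by (metis add.right_inverse lin_def lin_0 add_eq_0_iff)

lemma lin_diff: "lin f \<Longrightarrow> f (x - y) = f x - f y"
  by (metis add_uminus_conv_diff lin_def lin_minus)

lemma lin_g: "lin g"
  by (simp add: lin_def g_add g_sc)

lemma lin_g': "lin g'"
  unfolding lin_def by (metis g_add g_sc g_g' g'_g)

lemmas g_0 [simp] = lin_0[OF lin_g] and g_diff = lin_diff[OF lin_g]

lemma B_g_left: "B (g x) y = B x (g' y)"
  by (metis B_g g_g')

lemma B_self: "B x x = q_real (q_re (B x x))"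
  by (rule q_real_if_self_cnj) (rule B_cnj)

lemma B_eq_0_commute: "B x y = 0 \<longleftrightarrow> B y x = 0"
  by (metis B_cnj q_cnj_eq_0_iff)

text \<open>Invariance of \<open>B\<close> gives \<open>B v v = q_cnj l * B v v * l\<close>, and
  norms are multiplicative.\<close>

lemma q_norm2_eigenvalue:
  assumes "g v = v \<star> l" "B v v \<noteq> 0"
  shows "q_norm2 l = 1"
proof -
  have "B v v = q_cnj l * B v v * l"
    using B_g[of v v] assms by (simp add: B_sc B_sc_left mult.assoc)
  then have "q_norm2 (B v v) = q_norm2 (B v v) * (q_norm2 l * q_norm2 l)"
    by (metis q_norm2_mult q_norm2_cnj mult.assoc mult.commute)
  then have "(q_norm2 l)\<^sup>2 = 1"
    using assms by (simp add: power2_eq_square)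
  then show ?thesis
    using q_norm2_nonneg[of l] by (simp add: power2_eq_1_iff)
qed

section \<open>Invariant subspaces and dimension\<close>

definition subsp :: "'v set \<Rightarrow> bool" where
  "subsp W \<longleftrightarrow> 0 \<in> W \<and> (\<forall>x\<in>W. \<forall>y\<in>W. x + y \<in> W) \<and> (\<forall>x\<in>W. \<forall>q. x \<star> q \<in> W)"

lemma subspD:
  assumes "subsp W"
  shows "0 \<in> W" "x \<in> W \<Longrightarrow> y \<in> W \<Longrightarrow> x + y \<in> W" "x \<in> W \<Longrightarrow> x \<star> q \<in> W"
    "x \<in> W \<Longrightarrow> - x \<in> W" "x \<in> W \<Longrightarrow> y \<in> W \<Longrightarrow> x - y \<in> W"
proof -
  show 1: "0 \<in> W" "x \<in> W \<Longrightarrow> y \<in> W \<Longrightarrow> x + y \<in> W" "x \<in> W \<Longrightarrow> x \<star> q \<in> W" for x y q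
    using assms by (auto simp: subsp_def)
  show m: "x \<in> W \<Longrightarrow> - x \<in> W" for x
    using 1(3)[of x "- 1"] by (simp add: sc_minus_right)
  show "x \<in> W \<Longrightarrow> y \<in> W \<Longrightarrow> x - y \<in> W"
    using 1(2)[of x "- y"] m by simp
qed

definition inv_subsp :: "'v set \<Rightarrow> bool" where
  "inv_subsp W \<longleftrightarrow> subsp W \<and> (\<forall>x\<in>W. g x \<in> W \<and> g' x \<in> W)"

definition nondegenerate :: "'v set \<Rightarrow> bool" where
  "nondegenerate W \<longleftrightarrow> (\<forall>x\<in>W. (\<forall>y\<in>W. B x y = 0) \<longrightarrow> x = 0)"

definition functional :: "('v \<Rightarrow> quat) \<Rightarrow> bool" where
  "functional f \<longleftrightarrow> (\<forall>x y. f (x + y) = f x + f y) \<and> (\<forall>x q. f (x \<star> q) = f x * q)"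

text \<open>The dimension bound is expressed dually: \<open>m\<close> linear functionals separate the points of \<open>W\<close>.\<close>
definition dim_le :: "'v set \<Rightarrow> nat \<Rightarrow> bool" where
  "dim_le W m \<longleftrightarrow> (\<exists>\<phi>. (\<forall>i. functional (\<phi> i)) \<and> (\<forall>x\<in>W. (\<forall>i<m. \<phi> i x = 0) \<longrightarrow> x = 0))"

lemma functional_0: "functional f \<Longrightarrow> f 0 = 0"
  by (metis functional_def mult_zero_right sc_0_right)

lemma functional_diff: "functional f \<Longrightarrow> f (x - y) = f x - f y"
  by (metis functional_def eq_diff_eq diff_add_cancel)

lemma dim_le_mono: "dim_le W m \<Longrightarrow> W' \<subseteq> W \<Longrightarrow> dim_le W' m"
  unfolding dim_le_def by blast

text \<open>Multiples of a functional \<open>\<phi> k\<close> with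
  \<open>\<phi> k u \<noteq> 0\<close> are subtracted from the others to make them vanish at
  \<open>u\<close>, and \<open>\<phi> k\<close> is dropped. If the new functionals vanish at
  \<open>x\<close>, all old ones vanish at some \<open>x - u \<star> q\<close>, so \<open>x\<close>
  is a multiple of \<open>u\<close> in \<open>W'\<close>.\<close>

lemma dim_le_Suc_hyperplane:
  assumes dim: "dim_le W (Suc m)" and W: "subsp W" and u: "u \<in> W" and W': "W' \<subseteq> W"
    and uW': "\<And>q. u \<star> q \<in> W' \<Longrightarrow> u \<star> q = 0" and "u \<noteq> 0"
  shows "dim_le W' m"
proof -
  obtain \<phi> where \<phi>: "\<And>i. functional (\<phi> i)" "\<And>x. x \<in> W \<Longrightarrow> (\<And>i. i < Suc m \<Longrightarrow> \<phi> i x = 0) \<Longrightarrow> x = 0"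
    using dim unfolding dim_le_def by blast
  obtain k where k: "k < Suc m" "\<phi> k u \<noteq> 0"
    using \<phi>(2)[OF u] \<open>u \<noteq> 0\<close> by blast
  \<comment> \<open>This enumerates the numbers below \<open>Suc m\<close> other than
    \<open>k\<close> by the indices below \<open>m\<close>, with \<open>m\<close> standing in for
    \<open>k\<close>.\<close>
  define s where "s i = (if i = k then m else i)" for i
  define \<psi> where "\<psi> i x = \<phi> (s i) x - \<phi> (s i) u * inverse (\<phi> k u) * \<phi> k x" for i x
  have "functional (\<psi> i)" for i
    using \<phi>(1)[of "s i"] \<phi>(1)[of k] by (simp add: functional_def \<psi>_def algebra_simps)
  moreover have "x = 0" if x: "x \<in> W'" and 0: "\<And>i. i < m \<Longrightarrow> \<psi> i x = 0" for x
  proof -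
    define q where "q = inverse (\<phi> k u) * \<phi> k x"
    have "x - u \<star> q = 0"
    proof (rule \<phi>(2))
      show "x - u \<star> q \<in> W"
        using x W' u by (auto intro!: subspD[OF W])
      fix i assume i: "i < Suc m"
      have eq: "\<phi> i (x - u \<star> q) = \<phi> i x - \<phi> i u * q"
        using functional_diff[OF \<phi>(1)] \<phi>(1)[of i] by (simp add: functional_def)
      show "\<phi> i (x - u \<star> q) = 0"
      proof (cases "i = k")
        case True
        then show ?thesis
          using k unfolding eq by (simp add: q_def flip: mult.assoc)
      next
        case False
        define j where "j = (if i = m then k else i)"
        have "j < m" "s j = i"
          using False i k by (auto simp: j_def s_def)
        then show ?thesis
          using 0[of j] unfolding eq by (simp add: q_def \<psi>_def mult.assoc)
      qed
    qed
    then show "x = 0"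
      using uW'[of q] x by simp
  qed
  ultimately show ?thesis
    unfolding dim_le_def by blast
qed

lemma dim_le_0: "dim_le W 0 \<Longrightarrow> x \<in> W \<Longrightarrow> x = 0"
  by (auto simp: dim_le_def)

subsection \<open>Eigenvectors\<close>

text \<open>Horner evaluation of \<open>p\<close> at \<open>g\<close>, with the coefficients as
  right scalars. Restriction of scalars to the complex numbers makes the fundamental theorem of
  algebra applicable.\<close>

definition act :: "complex poly \<Rightarrow> 'v \<Rightarrow> 'v" where
  "act p x = fold_coeffs (\<lambda>c y. x \<star> q_complex c + g y) p 0"

lemma act_0 [simp]: "act 0 x = 0"
  by (simp add: act_def)

lemma act_pCons [simp]: "act (pCons c p) x = x \<star> q_complex c + g (act p x)"
  by (cases "c = 0 \<and> p = 0") (auto simp: act_def fold_coeffs_pCons_not_0_0_eq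
      fold_coeffs_pCons_coeff_not_0_eq simp flip: Qz_0)

lemma act_add_left: "act (p + q) x = act p x + act q x"
  by (induction p q rule: poly_induct2)
    (auto simp: sc_add_right g_add algebra_simps simp flip: Qz_add[of _ 0 _ 0, simplified])

lemma act_smult: "act (smult c p) x = act p x \<star> q_complex c"
  by (induction p) (auto simp: sc_add g_sc Qz_mult mult.commute)

lemma act_add: "act p (x + y) = act p x + act p y"
  by (induction p) (auto simp: sc_add g_add)

lemma act_sc: "act p (x \<star> q_complex c) = act p x \<star> q_complex c"
  by (induction p) (auto simp: sc_add g_sc Qz_mult mult.commute)

lemma act_g: "act p (g x) = g (act p x)"
  by (induction p) (auto simp: g_add g_sc)

lemma act_linear_factor: "act ([:- z, 1:] * q) x = g (act q x) - act q x \<star> q_complex z"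
proof -
  have "q_complex (- z) = - q_complex z"
    by (simp add: Qz_uminus)
  moreover have "[:- z, 1:] * q = smult (- z) q + pCons 0 q"
    by simp
  ultimately show ?thesis
    by (simp add: act_add_left act_smult sc_minus_right del: smult_minus_left flip: Qz_0)
qed

lemma act_linear_factor': "act ([:- z, 1:] * q) x = act q (g x - x \<star> q_complex z)"
proof -
  have "act q (g x - x \<star> q_complex z) + act q x \<star> q_complex z = g (act q x)"
    by (simp add: act_add act_g flip: act_sc act_add)
  then show ?thesis
    unfolding act_linear_factor by (simp add: algebra_simps)
qed

lemma act_monom: "act (monom c k) x = (g ^^ k) x \<star> q_complex c"
  by (induction k) (auto simp: monom_Suc monom_0 g_sc simp flip: Qz_0)

lemma act_sum: "act (sum f A) x = (\<Sum>k\<in>A. act (f k) x)"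
  by (induction A rule: infinite_finite_induct) (auto simp: act_add_left)

lemma act_in: "inv_subsp W \<Longrightarrow> x \<in> W \<Longrightarrow> act p x \<in> W"
  by (induction p) (auto simp: inv_subsp_def intro: subspD)

text \<open>For \<open>P x \<longleftrightarrow> x \<noteq> 0\<close> this is the existence of eigenvectors; for \<open>P x \<longleftrightarrow> x \<notin> U\<close> with an
  invariant subspace \<open>U\<close> it provides moreover an eigenvector in the quotient by \<open>U\<close>.\<close>
lemma act_root_eigenvector:
  assumes "inv_subsp W" "p \<noteq> 0" "w \<in> W" "P w" "act p w = 0" and P: "\<And>x. P x \<Longrightarrow> x \<noteq> 0"
  shows "\<exists>z y x. y \<in> W \<and> y \<noteq> 0 \<and> g y = y \<star> q_complex z \<and>
    x \<in> W \<and> P x \<and> \<not> P (g x - x \<star> q_complex z)"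
  using assms(2-5)
proof (induction "degree p" arbitrary: p w rule: less_induct)
  case less
  have "\<not> constant (poly p)"
  proof
    assume "constant (poly p)"
    then obtain c where "p = [:c:]"
      by (metis constant_degree degree_eq_zeroE)
    moreover have "q_complex c \<noteq> 0"
      using \<open>p = [:c:]\<close> less.prems(1) by simp
    ultimately show False
      using less.prems(4) P[OF less.prems(3)] by (simp del: Qz_eq_0_iff)
  qed
  then obtain z where "poly p z = 0"
    using fundamental_theorem_of_algebra by blast
  then obtain q where p: "p = [:- z, 1:] * q"
    using poly_eq_0_iff_dvd by blast
  have q: "q \<noteq> 0"
    using p less.prems(1) by (metis mult_zero_right)
  have deg: "degree q < degree p"
    unfolding p using q by (subst degree_mult_eq) auto
  define x where "x = g w - w \<star> q_complex z"
  have x: "x \<in> W" "act q x = 0"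
    using assms(1) less.prems(2) less.prems(4)[unfolded p act_linear_factor'] unfolding x_def
    by (simp_all add: inv_subsp_def subspD)
  \<comment> \<open>The first two cases recurse on \<open>q\<close>, starting from \<open>x\<close>
    or from \<open>w\<close>. In the third, \<open>act q w\<close> is an eigenvector and
    \<open>w\<close> is one up to an error violating \<open>P\<close>, both for the root
    \<open>z\<close>.\<close>
  consider "P x" | "act q w = 0" | "\<not> P x" "act q w \<noteq> 0"
    by blast
  then show ?case
  proof cases
    case 1
    then show ?thesis
      by (intro less.hyps[OF deg q x(1) _ x(2)])
  next
    case 2
    then show ?thesis
      by (intro less.hyps[OF deg q less.prems(2,3)])
  next
    case 3
    have "g (act q w) = act q w \<star> q_complex z"
      using less.prems(4) unfolding p act_linear_factor by simp
    moreover have "\<not> P (g w - w \<star> q_complex z)"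
      using 3 by (simp only: x_def not_False_eq_True)
    ultimately show ?thesis
      using 3(2) less.prems(2,3) act_in[OF assms(1) less.prems(2), of q]
      by (rule_tac exI[of _ z], rule_tac exI[of _ "act q w"], rule_tac exI[of _ w]) simp
  qed
qed

text \<open>Index \<open>i\<close> is meant for functional number \<open>i div 2\<close>, and its
  parity selects one of the two complex coordinates, so \<open>m\<close> quaternionic functionals
  become \<open>2 * m\<close> complex ones.\<close>

definition coord :: "nat \<Rightarrow> quat \<Rightarrow> complex" where
  "coord i q = (if even i then Complex (q_re q) (q_i q) else Complex (q_j q) (- q_k q))"

lemma coord_Qz: "coord i (Qz a b) = (if even i then a else b)"
  by (simp add: coord_def Qz_def)

text \<open>The functionals impose \<open>2 * m\<close> complex linear equations on a combination of
  the \<open>2 * m + 1\<close> vectors \<open>(g ^^ k) w\<close>, so a nontrivial combination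
  vanishes.\<close>

lemma ex_act_eq_0:
  assumes "dim_le W m" "inv_subsp W" "w \<in> W"
  obtains p where "p \<noteq> 0" "act p w = 0"
proof -
  obtain \<phi> where \<phi>: "\<And>i. functional (\<phi> i)" "\<And>x. x \<in> W \<Longrightarrow> (\<And>i. i < m \<Longrightarrow> \<phi> i x = 0) \<Longrightarrow> x = 0"
    using assms(1) unfolding dim_le_def by blast
  define N where "N = Suc (2 * m)"
  define r where "r i = vec N (\<lambda>k. coord i (\<phi> (i div 2) ((g ^^ k) w)))" for i
  \<comment> \<open>The zero row with index \<open>2 * m\<close> makes the matrix square and
    singular.\<close>
  define A where "A = mat N N (\<lambda>(i, k). if i = 2 * m then 0 else r i $ k)"
  have A: "A \<in> carrier_mat N N"
    by (simp add: A_def)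
  have "det A = 0"
  proof -
    have "A = mat\<^sub>r N N (\<lambda>i. if i = 2 * m then 0\<^sub>v N else r i)"
      by (intro eq_matI) (auto simp: A_def)
    then show ?thesis
      by (simp only:, intro det_row_0) (auto simp: N_def r_def)
  qed
  then obtain v where v: "v \<in> carrier_vec N" "v \<noteq> 0\<^sub>v N" "A *\<^sub>v v = 0\<^sub>v N"
    using det_0_iff_vec_prod_zero_field[OF A] by blast
  have Av: "(\<Sum>k<N. coord i (\<phi> (i div 2) ((g ^^ k) w)) * v $ k) = 0" if "i < 2 * m" for i
  proof -
    have "(A *\<^sub>v v) $ i = r i \<bullet> v"
      using that v(1) by (auto simp: r_def N_def A_def scalar_prod_def intro!: sum.cong)
    also have "\<dots> = (\<Sum>k<N. coord i (\<phi> (i div 2) ((g ^^ k) w)) * v $ k)"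
      using v(1) by (auto simp: scalar_prod_def r_def lessThan_atLeast0 intro!: sum.cong)
    finally show ?thesis
      using v(3) that by (simp add: N_def)
  qed
  define p where "p = (\<Sum>k<N. monom (v $ k) k)"
  have coeff: "coeff p k = (if k < N then v $ k else 0)" for k
    by (simp add: p_def coeff_sum)
  have "p \<noteq> 0"
  proof
    assume "p = 0"
    then have "v = 0\<^sub>v N"
      using coeff v(1) by (intro eq_vecI) (metis carrier_vecD coeff_0 index_zero_vec(1,2), auto)
    with v(2) show False ..
  qed
  moreover have "act p w = 0"
  proof (rule \<phi>(2))
    show "act p w \<in> W"
      using assms by (intro act_in)
    fix i assume i: "i < m"
    have sum: "\<phi> i (sum f X) = (\<Sum>k\<in>X. \<phi> i (f k))" for f and X :: "nat set"
      using functional_0[OF \<phi>(1)[of i]] \<phi>(1)[of i]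
      by (induction X rule: infinite_finite_induct) (auto simp: functional_def)
    define a where "a k = coord 0 (\<phi> i ((g ^^ k) w))" for k
    define b where "b k = coord 1 (\<phi> i ((g ^^ k) w))" for k
    have ab: "\<phi> i ((g ^^ k) w) = Qz (a k) (b k)" for k
      unfolding a_def b_def by (cases "\<phi> i ((g ^^ k) w)" rule: Qz_cases) (simp add: coord_Qz)
    have "\<phi> i (act p w) = (\<Sum>k<N. Qz (a k) (b k) * q_complex (v $ k))"
      using \<phi>(1)[of i] by (simp add: p_def act_sum act_monom sum functional_def ab)
    also have "\<dots> = Qz (\<Sum>k<N. a k * v $ k) (\<Sum>k<N. b k * v $ k)"
    proof -
      have "(\<Sum>k\<in>X. Qz (a k) (b k) * q_complex (v $ k)) =
          Qz (\<Sum>k\<in>X. a k * v $ k) (\<Sum>k\<in>X. b k * v $ k)" for X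
        by (induction X rule: infinite_finite_induct) (auto simp: Qz_0 Qz_simps)
      then show ?thesis .
    qed
    also have "\<dots> = 0"
      using Av[of "2 * i"] Av[of "2 * i + 1"] i by (simp add: a_def b_def coord_def)
    finally show "\<phi> i (act p w) = 0" .
  qed
  ultimately show ?thesis
    by (rule that)
qed

lemma ex_eigenvector:
  assumes "dim_le W m" "inv_subsp W" "w \<in> W" "P w" "\<And>x. P x \<Longrightarrow> x \<noteq> 0"
  obtains z y x where "y \<in> W" "y \<noteq> 0" "g y = y \<star> q_complex z"
    "x \<in> W" "P x" "\<not> P (g x - x \<star> q_complex z)"
  using ex_act_eq_0[OF assms(1-3)] act_root_eigenvector[of W _ w P] assms(2-5) by metis

subsection \<open>Splitting off an invariant subspace\<close>

text \<open>With \<open>f\<^sup>2 = -1\<close>, the last condition says that \<open>f\<close> conjugates \<open>g\<close> to its inverse.\<close>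
definition reversible_on :: "'v set \<Rightarrow> bool" where
  "reversible_on W \<longleftrightarrow> (\<exists>f. lin f \<and> (\<forall>x\<in>W. f x \<in> W \<and> f (f x) = - x \<and> f (g (f (g x))) = - x) \<and>
    (\<forall>x\<in>W. \<forall>y\<in>W. B (f x) (f y) = B x y))"

text \<open>\<open>P\<close> is the orthogonal projection onto an invariant subspace, and \<open>a\<close> reverses \<open>g\<close> there.\<close>
definition reversing_pair :: "('v \<Rightarrow> 'v) \<Rightarrow> ('v \<Rightarrow> 'v) \<Rightarrow> bool" where
  "reversing_pair P a \<longleftrightarrow> lin P \<and> lin a \<and> (\<forall>x. P (P x) = P x) \<and> (\<forall>x y. B (P x) y = B x (P y)) \<and>
    (\<forall>x. g (P x) = P (g x)) \<and> (\<forall>x. P (a x) = a x) \<and> (\<forall>x. a (P x) = a x) \<and>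
    (\<forall>x y. B (a x) (a y) = B (P x) y) \<and> (\<forall>x. a (a x) = - P x) \<and> (\<forall>x. a (g (a (g x))) = - P x)"

text \<open>\<open>W\<close> is the orthogonal sum of the image and the kernel of \<open>P\<close>
  on it. The kernel is again invariant and nondegenerate, and \<open>u\<close> accounts for the drop
  in dimension, so \<open>step\<close> applies to it. The two reversing maps are glued along the
  decomposition.\<close>

lemma reversible_on_split:
  assumes pair: "reversing_pair P a"
    and W: "inv_subsp W" "nondegenerate W" "dim_le W (Suc m)"
    and PW: "\<And>x. x \<in> W \<Longrightarrow> P x \<in> W" "\<And>x. x \<in> W \<Longrightarrow> a x \<in> W"
    and u: "u \<in> W" "u \<noteq> 0" "P u = u"
    and step: "\<And>W'. \<lbrakk>inv_subsp W'; nondegenerate W'; dim_le W' m; W' \<subseteq> W\<rbrakk> \<Longrightarrow> reversible_on W'"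
  shows "reversible_on W"
proof -
  have lin: "lin P" "lin a" and PP: "\<And>x. P (P x) = P x" and PB: "\<And>x y. B (P x) y = B x (P y)"
    and gP: "\<And>x. g (P x) = P (g x)" and Pa: "\<And>x. P (a x) = a x" and aP: "\<And>x. a (P x) = a x"
    and Ba: "\<And>x y. B (a x) (a y) = B (P x) y" and aa: "\<And>x. a (a x) = - P x"
    and agag: "\<And>x. a (g (a (g x))) = - P x"
    using pair by (auto simp: reversing_pair_def)
  have sub: "subsp W" and gW: "\<And>x. x \<in> W \<Longrightarrow> g x \<in> W" "\<And>x. x \<in> W \<Longrightarrow> g' x \<in> W"
    using W by (auto simp: inv_subsp_def)
  note linD = lin[unfolded lin_def]
  define W' where "W' = {x \<in> W. P x = 0}"
  have W'W: "W' \<subseteq> W"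
    by (auto simp: W'_def)
  have g'P: "g' (P x) = P (g' x)" for x
    by (metis gP g_g' g'_g)
  have compl: "x - P x \<in> W'" if "x \<in> W" for x
    using that PW by (auto simp: W'_def lin_diff lin PP intro: subspD[OF sub])
  have "inv_subsp W'"
    using linD gW lin_0[OF lin(1)] lin_0[OF lin_g']
    by (auto simp: inv_subsp_def subsp_def W'_def intro: subspD[OF sub] simp flip: gP g'P)
  moreover have "nondegenerate W'"
    unfolding nondegenerate_def
  proof (intro ballI impI)
    fix x assume x: "x \<in> W'" "\<forall>y\<in>W'. B x y = 0"
    have "B x y = 0" if "y \<in> W" for y
    proof -
      have "B x (P y) = 0"
        using x(1) by (simp add: W'_def flip: PB)
      moreover have "B x (y - P y) = 0"
        using x(2) compl[OF that] by blast
      ultimately show ?thesis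
        by (simp add: B_diff)
    qed
    then show "x = 0"
      using x(1) W(2) by (auto simp: W'_def nondegenerate_def)
  qed
  moreover have "dim_le W' m"
    by (rule dim_le_Suc_hyperplane[OF W(3) sub u(1) W'W _ u(2)]) (use u(3) linD in \<open>auto simp: W'_def\<close>)
  ultimately obtain f where f: "lin f" "\<And>x. x \<in> W' \<Longrightarrow> f x \<in> W'" "\<And>x. x \<in> W' \<Longrightarrow> f (f x) = - x"
    "\<And>x. x \<in> W' \<Longrightarrow> f (g (f (g x))) = - x" "\<And>x y. x \<in> W' \<Longrightarrow> y \<in> W' \<Longrightarrow> B (f x) (f y) = B x y"
    using step[of W'] W'W unfolding reversible_on_def by blast
  note fD = f(1)[unfolded lin_def]
  have gW': "g x \<in> W'" if "x \<in> W'" for x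
    using \<open>inv_subsp W'\<close> that by (simp add: inv_subsp_def)
  define h where "h x = a x + f (x - P x)" for x
  have h_add: "h (x + y) = h x + h y" for x y
  proof -
    have "x + y - P (x + y) = (x - P x) + (y - P y)"
      using linD by simp
    then have "h (x + y) = a (x + y) + f ((x - P x) + (y - P y))"
      by (simp only: h_def)
    also have "\<dots> = (a x + a y) + (f (x - P x) + f (y - P y))"
      using linD fD by metis
    finally show ?thesis
      by (simp only: h_def add.assoc add.left_commute)
  qed
  have h_sc: "h (x \<star> q) = h x \<star> q" for x q
  proof -
    have "x \<star> q - P (x \<star> q) = (x - P x) \<star> q"
      using linD by (simp add: sc_diff)
    then show ?thesis
      using linD fD by (simp add: h_def sc_add)
  qed
  have h1: "h x = a x" if "P x = x" for x
    by (simp add: h_def that lin_0 f)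
  have h2: "h x = f x" if "x \<in> W'" for x
    using that aP[of x] lin_0[OF lin(2)] by (simp add: h_def W'_def)
  have split: "x = P x + (x - P x)" for x
    by simp
  have "h (h x) = - x" if x: "x \<in> W" for x
  proof -
    have "h (h x) = h (a x) + h (f (x - P x))"
      unfolding h_def[of x] by (rule h_add)
    also have "\<dots> = - x"
      using compl[OF x] f(2,3) by (simp add: h1 h2 Pa aa)
    finally show ?thesis .
  qed
  moreover have "h (g (h (g x))) = - x" if x: "x \<in> W" for x
  proof -
    have gx: "g x - P (g x) = g (x - P x)"
      by (simp add: g_diff gP)
    have "h (g (h (g x))) = h (g (a (g x))) + h (g (f (g (x - P x))))"
      unfolding h_def[of "g x"] gx by (simp only: g_add h_add)
    also have "\<dots> = - x"
      using compl[OF x] f(2,4) gW' by (simp add: h1 h2 Pa agag flip: gP)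
    finally show ?thesis .
  qed
  moreover have "B (h x) (h y) = B x y" if x: "x \<in> W" "y \<in> W" for x y
  proof -
    \<comment> \<open>\<open>a x\<close> lies in the image of \<open>P\<close> and \<open>f\<close>
      keeps \<open>W'\<close> inside the kernel; these are orthogonal as \<open>P\<close> is
      self-adjoint.\<close>
    have cross: "B (a x) (f (y - P y)) = 0" if "y \<in> W" for x y
    proof -
      have "B (a x) (f (y - P y)) = B (a x) (P (f (y - P y)))"
        by (metis PB Pa)
      then show ?thesis
        using f(2)[OF compl[OF that]] by (simp add: W'_def)
    qed
    have "B (h x) (h y) = B (P x) y + B (x - P x) (y - P y)"
      using cross[OF x(2)] cross[OF x(1)] B_eq_0_commute f(5)[OF compl compl, OF x]
      by (simp add: h_def B_add B_add_left Ba)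
    also have "\<dots> = B x y"
      by (simp add: B_diff PB PP)
    finally show ?thesis .
  qed
  moreover have "h x \<in> W" if "x \<in> W" for x
    using that PW compl f(2) W'W by (auto simp: h_def intro!: subspD[OF sub])
  ultimately show ?thesis
    using h_add h_sc unfolding reversible_on_def lin_def by blast
qed

end


context quat_isometry
begin

subsection \<open>Reversing elementary subspaces\<close>

lemma sc_left_cancel: "v \<star> p = v \<star> q \<longleftrightarrow> v = 0 \<or> p = q"
  by (metis sc_diff_right sc_eq_0_iff right_minus_eq)

lemma B_g_eigenvector:
  assumes "g v = v \<star> l" "l \<noteq> 0"
  shows "B v (g x) = inverse (q_cnj l) * B v x"
proof -
  have "q_cnj l * B v (g x) = B v x"
    using B_g[of v x] by (simp add: assms(1) B_sc_left)
  then have "inverse (q_cnj l) * (q_cnj l * B v (g x)) = inverse (q_cnj l) * B v x"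
    by simp
  then show ?thesis
    using assms(2) by (simp flip: mult.assoc)
qed

lemma B_g_unit_eigenvector:
  assumes "g v = v \<star> l" "q_norm2 l = 1"
  shows "B v (g x) = l * B v x"
proof -
  have "l \<noteq> 0"
    using assms(2) by (metis q_norm2_eq_0_iff zero_neq_one)
  moreover have "inverse (q_cnj l) = l"
    using q_unit_inverse(1)[of "q_cnj l"] assms(2) by simp
  ultimately show ?thesis
    using B_g_eigenvector[OF assms(1)] by simp
qed

text \<open>In the coordinate \<open>c\<close> along \<open>u\<close>, \<open>g\<close> is left
  multiplication by the unit \<open>l\<close> and \<open>a\<close> is left multiplication by
  \<open>p\<close>, which inverts \<open>l\<close> since \<open>p * l = q_cnj l * p\<close>. The
  form is preserved because \<open>B u u\<close> is real and \<open>p\<close> has norm 1.\<close>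

lemma reversing_pair_nonnull:
  assumes gu: "g u = u \<star> l" and u: "B u u \<noteq> 0"
  obtains P a where "reversing_pair P a" "P u = u" "\<And>x. \<exists>q. P x = u \<star> q" "\<And>x. \<exists>q. a x = u \<star> q"
proof -
  have l: "q_norm2 l = 1"
    using assms by (rule q_norm2_eigenvalue)
  obtain p where p: "p * p = - 1" "q_cnj p = - p" "p * l = q_cnj l * p"
    by (rule ex_anticommuting_unit)
  define b where "b = q_re (B u u)"
  have b: "B u u = q_real b" "b \<noteq> 0"
    using B_self[of u] u by (auto simp: b_def)
  define c where "c x = q_real (inverse b) * B u x" for x
  define P where "P x = u \<star> c x" for x
  define a where "a x = u \<star> (p * c x)" for x
  have Bu: "B u x = q_real b * c x" for x
    using b by (simp add: c_def flip: mult.assoc) (simp add: Qz_mult flip: Qz_1)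
  have cu: "c u = 1"
    using b by (simp add: c_def Qz_mult)
  have c_add: "c (x + y) = c x + c y" and c_sc: "c (x \<star> q) = c x * q" for x y q
    by (simp_all add: c_def B_add B_sc algebra_simps)
  have c_g: "c (g x) = l * c x" for x
    unfolding c_def B_g_unit_eigenvector[OF gu l] by (metis q_real_commute mult.assoc)
  have B_u: "B x u = q_cnj (c x) * q_real b" for x
    using arg_cong[OF Bu[of x], of q_cnj] by (simp add: B_cnj)
  have pp: "p * (p * q) = - q" "l * (p * q) = p * (q_cnj l * q)" "q_cnj l * (l * q) = q" for q
    using p q_unit_inverse(3)[OF l] anticommuting_unit_swap[OF p(3)] by (simp_all flip: mult.assoc)
  have "reversing_pair P a"
    unfolding reversing_pair_def lin_def
    by (auto simp: P_def a_def c_add c_sc c_g cu B_u Bu B_sc B_sc_left sc_add_right sc_minus_right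
        g_sc gu algebra_simps p(2) pp b(1) q_real_commute[of b])
  then show ?thesis
    by (rule that) (auto simp: P_def a_def cu)
qed

text \<open>In the next two lemmas the reversing map multiplies coordinates by the imaginary unit \<open>p\<close>
  after swapping \<open>v\<close> and \<open>w\<close> (first lemma) or changing the sign of \<open>x\<close> (second lemma).\<close>
lemma reversing_pair_hyperbolic:
  assumes gv: "g v = v \<star> l" and gw: "g w = w \<star> inverse (q_cnj l)" and l: "l \<noteq> 0"
    and B: "B v v = 0" "B w w = 0" "B v w = 1"
  obtains P a where "reversing_pair P a" "P v = v" "\<And>x. \<exists>q r. P x = v \<star> q + w \<star> r"
    "\<And>x. \<exists>q r. a x = v \<star> q + w \<star> r"
proof -
  have Bwv: "B w v = 1"
    using B(3) B_cnj[of v w] by simp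
  obtain p where p: "p * p = - 1" "q_cnj p = - p" "p * l = q_cnj l * p"
    by (rule ex_anticommuting_unit)
  have lp: "l * p = p * q_cnj l"
    using p(3) by (rule anticommuting_unit_swap)
  define L where "L = q_cnj l"
  define M where "M = inverse L"
  have L: "L \<noteq> 0"
    using l by (simp add: L_def)
  have Bv: "B v (g x) = M * B v x" for x
    unfolding M_def L_def by (rule B_g_eigenvector) fact+
  have Bw: "B w (g x) = l * B w x" for x
  proof -
    have "L * M = 1"
      using L by (simp add: M_def)
    then have "q_cnj M * l = 1"
      by (metis L_def q_cnj_simps(2,3,6))
    then have "inverse (q_cnj M) = l"
      by (metis inverse_unique)
    with B_g_eigenvector[of w M x] show ?thesis
      using gw L by (simp add: M_def L_def)
  qed
  \<comment> \<open>Since \<open>v\<close> and \<open>w\<close> are null with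
    \<open>B v w = 1\<close>, the coordinate of \<open>x\<close> along \<open>v\<close> is
    \<open>B w x\<close>, and along \<open>w\<close> it is \<open>B v x\<close>. Without exchanging
    them in \<open>a\<close>, the factor \<open>p * l * p * l\<close> would appear, which is minus
    \<open>q_norm2 l\<close>.\<close>
  define P where "P x = v \<star> B w x + w \<star> B v x" for x
  define a where "a x = v \<star> (p * B v x) + w \<star> (p * B w x)" for x
  have 1: "l * (p * q) = p * (L * q)" "p * (p * q) = - q" "L * (M * q) = q" "M * (L * q) = q" for q
    using p L lp by (simp_all add: M_def L_def flip: mult.assoc)
  have 2: "p * (l * q) = L * (p * q)" for q
    using p by (simp add: L_def flip: mult.assoc)
  have gw': "g w = w \<star> M"
    using gw by (simp add: M_def L_def)
  have lin: "lin P" "lin a"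
    by (auto simp: lin_def P_def a_def B_add B_sc sc_add_right sc_add algebra_simps)
  have BP: "B v (P x) = B v x" "B w (P x) = B w x" for x
    by (simp_all add: P_def B_add B_sc B Bwv)
  have Ba: "B v (a x) = p * B w x" "B w (a x) = p * B v x" for x
    by (simp_all add: a_def B_add B_sc B Bwv)
  have cnj: "q_cnj (B v x) = B x v" "q_cnj (B w x) = B x w" for x
    by (rule B_cnj)+
  have "reversing_pair P a"
    unfolding reversing_pair_def
  proof (intro conjI allI lin)
    fix x y
    show "P (P x) = P x" "P (a x) = a x" "a (P x) = a x"
      by (simp_all add: P_def[of "P x"] P_def[of "a x"] a_def[of "P x"] BP Ba)
        (simp_all add: P_def a_def)
    show "B (P x) y = B x (P y)"
      by (simp add: P_def B_add B_add_left B_sc B_sc_left cnj add.commute)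
    show "g (P x) = P (g x)"
      by (simp add: P_def g_add g_sc gv gw' Bv Bw)
    show "B (a x) (a y) = B (P x) y"
      by (subst (1) a_def) (simp add: P_def B_add_left B_sc_left Ba cnj p(2) 1 algebra_simps)
    show "a (a x) = - P x"
      by (subst (1) a_def) (simp add: Ba P_def 1 sc_minus_right)
    show "a (g (a (g x))) = - P x"
      by (subst (1) a_def) (simp add: Ba Bv Bw P_def 1 2 sc_minus_right)
  qed
  then show ?thesis
    by (rule that) (auto simp: P_def a_def B Bwv)
qed

lemma reversing_pair_parabolic:
  fixes k :: real
  defines "K \<equiv> q_real k" and "H \<equiv> q_real (k * k / 2)"
  assumes gv: "g v = v \<star> l" and gx: "g x = (x + v \<star> K) \<star> l"
    and gw: "g w = (w - x \<star> K + v \<star> (t - H)) \<star> l" and l: "q_norm2 l = 1"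
    and B: "B v v = 0" "B w w = 0" "B v w = 1" "B v x = 0" "B w x = 0"
    and x: "B x x = 1 \<or> x = 0 \<and> k = 0"
    and t: "q_cnj t = - t" "t * l = l * t" and p: "p * p = - 1" "q_cnj p = - p" "p * l = q_cnj l * p"
      "p * t = - t * p"
  obtains P a where "reversing_pair P a" "P v = v" "\<And>y. \<exists>q r s. P y = v \<star> q + w \<star> r + x \<star> s"
    "\<And>y. \<exists>q r s. a y = v \<star> q + w \<star> r + x \<star> s"
proof -
  have B': "B w v = 1" "B x v = 0" "B x w = 0"
    using B B_cnj[of v w] B_cnj[of v x] B_cnj[of w x] by auto
  have K: "q * K = K * q" "q_cnj K = K" and H: "q * H = H * q" "q_cnj H = H" for q
    unfolding K_def H_def by (rule q_real_commute[symmetric] q_cnj_real)+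
  have HH: "K * K = H + H"
    by (simp add: K_def H_def Qz_simps flip: of_real_add of_real_mult)
  have lp: "l * p = p * q_cnj l"
    using p(3) by (rule anticommuting_unit_swap)
  define L where "L = q_cnj l"
  have LI: "q_cnj l * q = r \<longleftrightarrow> q = l * r" for q r
    using q_unit_inverse(2,3)[OF l] by (metis mult.assoc mult_1_left)
  have Bv: "B v (g y) = l * B v y" for y
    by (rule B_g_unit_eigenvector) fact+
  have Bx: "B x (g y) = l * (B x y - K * B v y)" for y
  proof -
    have "B (g x) (g y) = q_cnj l * (B x (g y) + K * B v (g y))"
      by (simp only: gx B_sc_left B_add_left K(2))
    then have "B x (g y) + K * B v (g y) = l * B x y"
      by (metis LI B_g)
    then have "B x (g y) = l * B x y - K * B v (g y)"
      by (simp add: algebra_simps)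
    then show ?thesis
      by (simp add: Bv algebra_simps K(1)[of l] flip: mult.assoc)
  qed
  have Bw: "B w (g y) = l * (B w y + K * B x y + (t - H) * B v y)" for y
  proof -
    have "B (g w) (g y) = q_cnj l * (B w (g y) - K * B x (g y) + (- t - H) * B v (g y))"
      by (simp only: gw B_sc_left B_add_left B_diff K(2) H(2) q_cnj_diff t)
    then have "B w (g y) - K * B x (g y) + (- t - H) * B v (g y) = l * B w y"
      by (metis LI B_g)
    then have "B w (g y) = l * B w y + K * B x (g y) + (t + H) * B v (g y)"
      by (simp add: algebra_simps)
    also have "\<dots> = l * (B w y + K * B x y + (t + H - K * K) * B v y)"
      by (simp add: Bx Bv algebra_simps K(1)[of l] K(1)[of "K * l"] H(1)[of l] t(2) flip: mult.assoc)
    also have "t + H - K * K = t - H"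
      by (simp add: HH)
    finally show ?thesis .
  qed
  \<comment> \<open>The alternative \<open>x = 0\<close>, \<open>k = 0\<close> covers the
    two-dimensional case; these identities serve both alternatives.\<close>
  have Bxx: "x \<star> (B x x * q) = x \<star> q" "B x x * B x y = B x y" "B x x * K = K" for q y
    using x by (auto simp: K_def simp flip: Qz_0)
  define P where "P y = v \<star> B w y + w \<star> B v y + x \<star> B x y" for y
  \<comment> \<open>In these coordinates \<open>g\<close> is \<open>l\<close> times the exponential
    of the nilpotent map with \<open>v\<close> to 0, \<open>x\<close> to \<open>v \<star> K\<close>
    and \<open>w\<close> to \<open>v \<star> t - x \<star> K\<close>; \<open>H\<close> is its
    second-order term. The sign at \<open>x\<close> negates \<open>K\<close>, and conjugation by
    \<open>p\<close> negates \<open>t\<close> and inverts \<open>l\<close>.\<close>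
  define a where "a y = v \<star> (p * B w y) + w \<star> (p * B v y) - x \<star> (p * B x y)" for y
  have lin: "lin P" "lin a"
    by (auto simp: lin_def P_def a_def B_add B_sc sc_add_right sc_add sc_diff algebra_simps)
  have BP: "B v (P y) = B v y" "B w (P y) = B w y" "B x (P y) = B x y" for y
    by (simp_all add: P_def B_add B_sc B B' Bxx)
  have pB: "B x x * (p * B x y) = p * B x y" for y
    using x by auto
  have Ba: "B v (a y) = p * B v y" "B w (a y) = p * B w y" "B x (a y) = - (p * B x y)" for y
    by (simp_all add: a_def B_add B_diff B_sc B B' pB)
  have cnj: "q_cnj (B v y) = B y v" "q_cnj (B w y) = B y w" "q_cnj (B x y) = B y x" for y
    by (rule B_cnj)+
  have tl: "l * (t * q) = t * (l * q)" and pt: "p * (t * q) = - (t * (p * q))"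
    and pp: "p * (p * q) = - q" and lpq: "l * (p * q) = p * (L * q)" and Ll: "L * (l * q) = q"
    and Kq: "l * (K * q) = K * (l * q)" "p * (K * q) = K * (p * q)" "t * (K * q) = K * (t * q)"
    and Hq: "l * (H * q) = H * (l * q)" "p * (H * q) = H * (p * q)" "t * (H * q) = H * (t * q)"
    and KK: "K * (K * q) = H * q + H * q" for q
    using t(2) p lp q_unit_inverse(3)[OF l]
    by (simp_all add: L_def K(1)[of l] K(1)[of p] K(1)[of t] H(1)[of l] H(1)[of p] H(1)[of t] HH
        distrib_right flip: mult.assoc)
  note rules = tl pt pp lpq Ll Kq Hq KK
  have "reversing_pair P a"
    unfolding reversing_pair_def
  proof (intro conjI allI lin)
    fix y z
    show "P (P y) = P y"
      unfolding P_def[of "P y"] BP by (simp add: P_def)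
    show "a (P y) = a y"
      unfolding a_def BP ..
    show "P (a y) = a y"
      unfolding P_def[of "a y"] Ba by (simp add: a_def sc_minus_right)
    show "B (P y) z = B y (P z)"
      by (simp add: P_def B_add B_add_left B_sc B_sc_left cnj algebra_simps)
    show "g (P y) = P (g y)"
      by (simp add: P_def g_add g_sc gv gw gx Bv Bw Bx sc_add sc_diff sc_add_right sc_diff_right
          algebra_simps rules)
    show "B (a y) (a z) = B (P y) z"
      by (subst (1) a_def) (simp add: P_def B_add_left B_diff B_sc_left Ba cnj p(2) rules algebra_simps)
    show "a (a y) = - P y"
      by (subst (1) a_def) (simp add: Ba P_def rules sc_minus_right)
    show "a (g (a (g y))) = - P y"
      by (subst (1) a_def) (simp add: Ba Bv Bw Bx P_def rules sc_minus_right sc_add_right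
          sc_diff_right algebra_simps)
  qed
  then show ?thesis
  proof (rule that)
    show "P v = v"
      by (simp add: P_def B B')
    show "\<exists>q r s. P y = v \<star> q + w \<star> r + x \<star> s" for y
      unfolding P_def by blast
    have "a y = v \<star> (p * B w y) + w \<star> (p * B v y) + x \<star> (- (p * B x y))" for y
      by (simp add: a_def sc_minus_right)
    then show "\<exists>q r s. a y = v \<star> q + w \<star> r + x \<star> s" for y
      by blast
  qed
qed

end


section \<open>Isometries of Lorentzian spaces\<close>

text \<open>Signature (n,1) enters in this form: orthogonal to a nonzero null vector
  \<open>v\<close> of \<open>V\<close>, the form is positive off the line of \<open>v\<close>. In
  particular, orthogonal nonzero null vectors of \<open>V\<close> are proportional.\<close>

locale lorentz_isometry = quat_isometry +
  fixes V :: "'a set"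
  assumes lorentz: "\<lbrakk>v \<in> V; x \<in> V; v \<noteq> 0; B v v = 0; B v x = 0\<rbrakk> \<Longrightarrow>
    q_re (B x x) > 0 \<or> (\<exists>q. x = v \<star> q)"
begin

lemma nonnull_cases:
  assumes "v \<in> V" "x \<in> V" "v \<noteq> 0" "B v v = 0" "B v x = 0" "B x x \<noteq> 0"
  shows "q_re (B x x) > 0"
  using lorentz[OF assms(1-5)] assms(4,6) by (auto simp: B_sc B_sc_left)

text \<open>Modulo the line of \<open>v\<close> there is an eigenvector \<open>x\<close> in
  \<open>N\<close>. It is non-null by the signature, so its eigenvalue has modulus 1 and the pair
  normal form applies. It yields either a non-null eigenvector, excluded by \<open>null\<close>, or
  a Jordan vector over \<open>v\<close>.\<close>

lemma ex_jordan_pair: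
  assumes W: "W \<subseteq> V" "subsp W" "dim_le W m" and null: "\<forall>u\<in>W. \<forall>q. g u = u \<star> q \<longrightarrow> B u u = 0"
    and v: "v \<noteq> 0" "B v v = 0" "g v = v \<star> q_complex l" and l: "cmod l = 1"
    and N: "inv_subsp N" "N \<subseteq> W" "v \<in> N" "\<forall>x\<in>N. B v x = 0"
    and x0: "x0 \<in> N" "\<nexists>q. x0 = v \<star> q"
  obtains y where "y \<in> N" "q_re (B y y) > 0" "g y = (y + v) \<star> q_complex l"
proof -
  have vV: "v \<in> V" and NV: "N \<subseteq> V" and subN: "subsp N"
    using N W by (auto simp: inv_subsp_def)
  have nz: "x \<noteq> 0" if "\<nexists>q. x = v \<star> q" for x
    using that sc_0_right[of v] by metis
  obtain z x where x: "x \<in> N" "\<nexists>q. x = v \<star> q" and "\<not> (\<nexists>q. g x - x \<star> q_complex z = v \<star> q)"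
    using ex_eigenvector[OF dim_le_mono[OF W(3) N(2)] N(1) x0(1), of "\<lambda>x. \<nexists>q. x = v \<star> q"] x0(2) nz
    by metis
  then obtain \<beta> where "g x - x \<star> q_complex z = v \<star> \<beta>"
    by blast
  then have gx: "g x = x \<star> q_complex z + v \<star> \<beta>"
    by (simp add: algebra_simps)
  have Bvx: "B v x = 0" "B x v = 0"
    using N(4) x(1) B_eq_0_commute by auto
  have Bxx: "q_re (B x x) > 0"
    using lorentz[OF vV _ v(1,2) Bvx(1)] x NV by blast
  then have Bxx0: "B x x \<noteq> 0"
    by (auto simp: zero_quat_def)
  have "B x x = q_cnj (q_complex z) * B x x * q_complex z"
    using B_g[of x x] unfolding gx
    by (simp add: B_add B_add_left B_sc B_sc_left Bvx v mult.assoc)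
  then have "q_norm2 (B x x) = q_norm2 (B x x) * (q_norm2 (q_complex z))\<^sup>2"
    by (metis q_norm2_mult q_norm2_cnj mult.assoc mult.commute power2_eq_square)
  then have "((cmod z)\<^sup>2)\<^sup>2 = 1"
    using Bxx0 by (simp add: q_norm2_Qz)
  then have z: "cmod z = 1"
    by (smt (verit) norm_ge_zero power2_eq_1_iff power2_less_0 zero_le_power2)
  consider \<gamma> where "\<beta> + q_complex l * \<gamma> = \<gamma> * q_complex z"
    | \<rho> \<gamma> where "\<rho> \<noteq> 0" "q_complex z * \<rho> = \<rho> * q_complex l"
      "\<beta> * \<rho> + q_complex l * \<gamma> = \<gamma> * q_complex l + q_complex l"
    using jordan_pair_normal_form[OF l z, of \<beta>] by blast
  then show ?thesis
  proof cases
    case 1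
    have "g (x + v \<star> \<gamma>) = x \<star> q_complex z + v \<star> (\<beta> + q_complex l * \<gamma>)"
      by (simp add: g_add g_sc gx v sc_add_right)
    also have "\<dots> = (x + v \<star> \<gamma>) \<star> q_complex z"
      by (simp add: 1 sc_add)
    finally have "B (x + v \<star> \<gamma>) (x + v \<star> \<gamma>) = 0"
      using null x(1) N(2,3) by (auto intro!: subspD[OF W(2)])
    then show ?thesis
      using Bxx0 by (simp add: B_add B_add_left B_sc B_sc_left Bvx v)
  next
    case 2
    define y where "y = x \<star> \<rho> + v \<star> \<gamma>"
    have "g y = x \<star> (q_complex z * \<rho>) + v \<star> (\<beta> * \<rho> + q_complex l * \<gamma>)"
      by (simp add: y_def g_add g_sc gx v sc_add_right sc_add)
    also have "\<dots> = (y + v) \<star> q_complex l"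
      by (simp add: 2 y_def sc_add sc_add_right)
    finally have gy: "g y = (y + v) \<star> q_complex l" .
    have y: "y \<in> N"
      using x(1) N(3) by (auto simp: y_def intro!: subspD[OF subN])
    have "B y y = q_cnj \<rho> * (B x x * \<rho>)"
      by (simp add: y_def B_add B_add_left B_sc B_sc_left Bvx v mult.assoc)
    then have "B y y \<noteq> 0"
      using Bxx0 2(1) by simp
    then have "q_re (B y y) > 0"
      using nonnull_cases[OF vV _ v(1,2)] N(4) y NV by blast
    from that[OF y this gy] show ?thesis .
  qed
qed

text \<open>This is the induction step on the dimension: each case constructs a reversing pair whose
  projection fixes a nonzero vector of \<open>W\<close>, and splits it off.\<close>

lemma reversible_on_step:
  assumes W: "inv_subsp W" "nondegenerate W" "dim_le W (Suc m)" "W \<subseteq> V" and w0: "w0 \<in> W" "w0 \<noteq> 0"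
    and step: "\<And>W'. \<lbrakk>inv_subsp W'; nondegenerate W'; dim_le W' m; W' \<subseteq> W\<rbrakk> \<Longrightarrow> reversible_on W'"
  shows "reversible_on W"
proof (cases "\<exists>u q. u \<in> W \<and> g u = u \<star> q \<and> B u u \<noteq> 0")
  case True
  have sub: "subsp W"
    using W(1) by (simp add: inv_subsp_def)
  from True obtain u q where u: "u \<in> W" "g u = u \<star> q" "B u u \<noteq> 0"
    by blast
  obtain P a where Pa: "reversing_pair P a" "P u = u" "\<And>x. \<exists>q. P x = u \<star> q" "\<And>x. \<exists>q. a x = u \<star> q"
    using reversing_pair_nonnull[OF u(2,3)] by blast
  show ?thesis
  proof (rule reversible_on_split[OF Pa(1) W(1-3) _ _ u(1) _ Pa(2) step])
    show "P x \<in> W" "a x \<in> W" for x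
      using Pa(3)[of x] Pa(4)[of x] u(1) by (auto intro: subspD[OF sub])
    show "u \<noteq> 0"
      using u(3) by auto
  qed
next
  case False
  then have null: "B u u = 0" if "u \<in> W" "g u = u \<star> q" for u q
    using that by blast
  have sub: "subsp W" and gW: "\<And>x. x \<in> W \<Longrightarrow> g x \<in> W" "\<And>x. x \<in> W \<Longrightarrow> g' x \<in> W"
    using W(1) by (auto simp: inv_subsp_def)
  note subW = subspD[OF sub]
  obtain v l where v: "v \<in> W" "v \<noteq> 0" "g v = v \<star> q_complex l"
    using ex_eigenvector[OF W(3,1) w0(1), of "\<lambda>x. x \<noteq> 0"] w0(2) by metis
  have Bvv: "B v v = 0"
    using null v by blast
  have l0: "q_complex l \<noteq> 0"
  proof
    assume "q_complex l = 0"
    then have "g' (g v) = g' 0"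
      using v(3) by (simp only: sc_0_right)
    then show False
      using v(2) lin_0[OF lin_g'] by simp
  qed
  obtain u0 where u0: "u0 \<in> W" "B v u0 \<noteq> 0"
    using W(2) v(1,2) by (auto simp: nondegenerate_def)
  show ?thesis
  proof (cases "cmod l = 1")
    case False
    \<comment> \<open>The vector \<open>x\<close> is an eigenvector modulo the complement of
      \<open>v\<close>; pairing it with \<open>v\<close> forces the moduli of \<open>l\<close> and
      \<open>z\<close> to have product 1. The vector \<open>y\<close> is a genuine eigenvector for
      the same \<open>z\<close>.\<close>
    obtain z y x where y: "y \<in> W" "y \<noteq> 0" "g y = y \<star> q_complex z"
      and x: "x \<in> W" "B v x \<noteq> 0" "\<not> B v (g x - x \<star> q_complex z) \<noteq> 0"
      using ex_eigenvector[OF W(3,1) u0(1), of "\<lambda>x. B v x \<noteq> 0"] u0(2) by (metis B_0(1))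
    define L where "L = q_cnj (q_complex l)"
    have L0: "L \<noteq> 0"
      using l0 by (simp add: L_def Qz_cnj)
    have LB: "L * B v (g u) = B v u" for u
      using B_g_eigenvector[OF v(3) l0, of u] L0 by (simp add: L_def flip: mult.assoc)
    have "B v x = L * B v x * q_complex z"
      using LB[of x] x(3) by (simp add: B_diff B_sc mult.assoc)
    then have "q_norm2 (B v x) = q_norm2 (B v x) * (q_norm2 (q_complex l) * q_norm2 (q_complex z))"
      unfolding L_def by (metis q_norm2_mult q_norm2_cnj mult.assoc mult.commute)
    then have lz: "(cmod l)\<^sup>2 * (cmod z)\<^sup>2 = 1"
      using x(2) by (simp add: q_norm2_Qz)
    have Byy: "B y y = 0"
      using null y by blast
    \<comment> \<open>Otherwise the null vector \<open>y\<close> is a multiple of \<open>v\<close>,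
      so \<open>l\<close> and \<open>z\<close> have equal modulus, which must then be 1.\<close>
    have "B v y \<noteq> 0"
    proof
      assume "B v y = 0"
      then obtain q where q: "y = v \<star> q"
        using lorentz[of v y] v y W(4) Bvv Byy by (auto simp: zero_quat_def)
      then have "v \<star> (q_complex l * q) = v \<star> (q * q_complex z)"
        using y(3) v(3) by (simp add: g_sc)
      then have "q_norm2 (q_complex l) * q_norm2 q = q_norm2 q * q_norm2 (q_complex z)"
        using v(2) by (simp only: sc_left_cancel simp_thms flip: q_norm2_mult)
      then have "(cmod l)\<^sup>2 = (cmod z)\<^sup>2"
        using q y(2) by (simp add: q_norm2_Qz)
      with lz have "((cmod l)\<^sup>2)\<^sup>2 = 1"
        by (simp add: power2_eq_square)
      then have "cmod l = 1"
        by (smt (verit) norm_ge_zero power2_eq_1_iff power2_less_0 zero_le_power2)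
      with False show False ..
    qed
    define t where "t = B v y"
    have t0: "t \<noteq> 0"
      using \<open>B v y \<noteq> 0\<close> by (simp add: t_def)
    define w where "w = y \<star> inverse t"
    have w: "w \<in> W" "B v w = 1" "B w w = 0"
      using y(1) t0 by (simp_all add: w_def subW B_sc B_sc_left Byy flip: t_def)
    have "L * (t * q_complex z) = t"
      using LB[of y] by (simp add: y(3) B_sc t_def)
    then have "t * q_complex z = inverse L * t"
      using L0 by (metis left_inverse mult.assoc mult_1_left)
    then have "q_complex z = inverse t * (inverse L * t)"
      using t0 by (metis left_inverse mult.assoc mult_1_left)
    then have "q_complex z * inverse t = inverse t * inverse L"
      using t0 by (simp add: mult.assoc)
    then have gw: "g w = w \<star> inverse L"
      by (simp add: w_def g_sc y(3))
    obtain P a where Pa: "reversing_pair P a" "P v = v" "\<And>x. \<exists>q r. P x = v \<star> q + w \<star> r"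
      "\<And>x. \<exists>q r. a x = v \<star> q + w \<star> r"
      using reversing_pair_hyperbolic[OF v(3) gw[unfolded L_def] l0 Bvv w(3,2)] by blast
    show ?thesis
    proof (rule reversible_on_split[OF Pa(1) W(1-3) _ _ v(1,2) Pa(2) step])
      show "P x \<in> W" "a x \<in> W" for x
        using Pa(3)[of x] Pa(4)[of x] v(1) w(1) by (auto intro!: subW)
    qed
  next
    case True
    define lq where "lq = q_complex l"
    have l1: "q_norm2 lq = 1"
      using True by (simp add: lq_def q_norm2_Qz)
    have lq0: "lq \<noteq> 0"
      using l0 by (simp only: lq_def not_False_eq_True)
    note li = q_unit_inverse[OF l1]
    have gv: "g v = v \<star> lq"
      by (simp add: lq_def v)
    have Bvg: "B v (g u) = lq * B v u" for u
      by (rule B_g_unit_eigenvector[OF gv l1])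
    have Bvg': "B v (g' u) = q_cnj lq * B v u" for u
      using Bvg[of "g' u"] li by (simp flip: mult.assoc)
    have "\<forall>u\<in>W. \<forall>q. g u = u \<star> q \<longrightarrow> B u u = 0"
      using null by blast
    note pair = ex_jordan_pair[OF W(4) sub W(3) this v(2) Bvv v(3) True]
    define N where "N = {x \<in> W. B v x = 0}"
    have N: "inv_subsp N" "N \<subseteq> W" "v \<in> N" "\<forall>x\<in>N. B v x = 0"
      using v(1) Bvv gW by (auto simp: N_def inv_subsp_def subsp_def subW B_add B_sc Bvg Bvg')
    \<comment> \<open>Either the complement of \<open>v\<close> in \<open>W\<close> is the line of
      \<open>v\<close>, encoded by \<open>x = 0\<close> and \<open>k = 0\<close>, or
      \<open>x\<close> is a normalized Jordan vector. The last property says that \<open>v\<close>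
      and \<open>x\<close> span the complement.\<close>
    obtain x k where x: "x \<in> W" "B v x = 0" "g x = (x + v \<star> q_real k) \<star> lq"
      "B x x = 1 \<or> x = 0 \<and> k = 0"
      "\<And>y. \<lbrakk>y \<in> W; B v y = 0; B x y = 0\<rbrakk> \<Longrightarrow> \<exists>q. y = v \<star> q"
    proof (cases "\<exists>x0. x0 \<in> N \<and> (\<nexists>q. x0 = v \<star> q)")
      case False
      then show ?thesis
        by (intro that[of 0 0]) (auto simp: N_def subW simp flip: Qz_0)
    next
      case True
      then obtain x0 where "x0 \<in> N" "\<nexists>q. x0 = v \<star> q"
        by blast
      then obtain y where y: "y \<in> N" "q_re (B y y) > 0" "g y = (y + v) \<star> lq"
        unfolding lq_def using pair[OF N] by blast
      define r where "r = q_re (B y y)"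
      define s where "s = 1 / sqrt r"
      have Byy: "B y y = q_real r"
        unfolding r_def by (rule B_self)
      define x where "x = y \<star> q_real s"
      have "s * (r * s) = 1"
        using y(2) by (simp add: s_def r_def)
      then have "q_real s * (q_real r * q_real s) = 1"
        by (simp add: Qz_mult flip: of_real_mult)
      then have Bxx: "B x x = 1"
        by (simp add: x_def B_sc B_sc_left Byy mult.assoc)
      have gx: "g x = (x + v \<star> q_real s) \<star> lq"
        unfolding x_def g_sc y(3) by (simp add: sc_add q_real_commute)
      have xW: "x \<in> W" and Bvx: "B v x = 0"
        using y(1) by (auto simp: x_def N_def subW B_sc)
      have "\<exists>q. u = v \<star> q" if u: "u \<in> W" "B v u = 0" "B x u = 0" for u
      proof (rule ccontr)
        assume nu: "\<nexists>q. u = v \<star> q"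
        \<comment> \<open>A further direction would give a second Jordan vector \<open>y2\<close>,
          orthogonal to \<open>y\<close>. The terms in \<open>v\<close> cancel in
          \<open>g (y2 - y)\<close>, so \<open>y2 - y\<close> is an eigenvector, and the form is
          positive at it.\<close>
        define N2 where "N2 = {u \<in> W. B v u = 0 \<and> B x u = 0}"
        have "B x (g u) = 0" if "B v u = 0" "B x u = 0" for u
        proof -
          have "q_cnj lq * (B x (g u) + q_real s * B v (g u)) = 0"
            using B_g[of x u] that(2) unfolding gx
            by (simp add: B_add_left B_sc_left)
          then show ?thesis
            using that(1) lq0 by (auto simp: Bvg)
        qed
        moreover have "B x (g' u) = 0" if "B v u = 0" "B x u = 0" for u
          using that by (simp add: gx B_add_left B_sc_left flip: B_g_left)
        ultimately have "inv_subsp N2"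
          using gW by (auto simp: N2_def inv_subsp_def subsp_def subW B_add B_sc Bvg Bvg')
        moreover have "v \<in> N2" "u \<in> N2" "N2 \<subseteq> W" "\<forall>x\<in>N2. B v x = 0"
          using v(1) Bvv u Bvx B_eq_0_commute by (auto simp: N2_def)
        ultimately obtain y2 where y2: "y2 \<in> N2" "q_re (B y2 y2) > 0" "g y2 = (y2 + v) \<star> lq"
          unfolding lq_def using pair[of N2 u] nu by blast
        have "s \<noteq> 0"
          using y(2) by (simp add: s_def r_def)
        moreover have "B x y2 = 0"
          using y2(1) by (simp add: N2_def)
        ultimately have "B y y2 = 0" "B y2 y = 0"
          using B_eq_0_commute by (auto simp: x_def B_sc_left Qz_cnj)
        then have "B (y2 - y) (y2 - y) = B y2 y2 + B y y"
          by (simp add: B_diff)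
        moreover have "B (y2 - y) (y2 - y) = 0"
          by (rule null[of _ lq]) (use y y2 in \<open>auto simp: N_def N2_def subW g_diff sc_add sc_diff\<close>)
        ultimately have "q_re (B y2 y2) + q_re (B y y) = 0"
          by (metis plus_quat_def quat.sel(1) zero_quat_def)
        with y(2) y2(2) show False
          by simp
      qed
      with xW Bvx gx Bxx show ?thesis
        by (intro that) auto
    qed
    define K where "K = q_real k"
    define H where "H = q_real (k * k / 2)"
    have K: "q_cnj K = K"
      unfolding K_def by (rule q_cnj_real)
    have H: "q_cnj H = H"
      unfolding H_def by (rule q_cnj_real)
    have HH: "K * K = H + H"
      by (simp add: K_def H_def Qz_simps flip: of_real_add of_real_mult)
    have Bxv: "B x v = 0"
      using x(2) B_eq_0_commute by blast
    \<comment> \<open>Completion to a basis: \<open>w1\<close> is scaled to pair to 1 with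
      \<open>v\<close>, \<open>w2\<close> is made orthogonal to \<open>x\<close>, and
      \<open>w3\<close> is made null by subtracting a multiple of \<open>v\<close>.\<close>
    define w1 where "w1 = u0 \<star> inverse (B v u0)"
    define w2 where "w2 = w1 - x \<star> B x w1"
    define h where "h = q_real (q_re (B w2 w2) / 2)"
    define w3 where "w3 = w2 - v \<star> h"
    have w1: "B v w1 = 1" "w1 \<in> W"
      using u0 by (simp_all add: w1_def B_sc subW)
    have w2: "B v w2 = 1" "B x w2 = 0" "w2 \<in> W"
      using w1 x by (auto simp: w2_def B_diff B_sc subW)
    have Bw2: "B w2 v = 1" "B w2 x = 0"
      using w2 B_cnj[of v w2] B_cnj[of x w2] by auto
    have "B w2 w2 = h + h"
      using B_self[of w2] by (simp add: h_def Qz_add flip: of_real_add)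
    moreover have "q_cnj h = h"
      unfolding h_def by (rule q_cnj_real)
    ultimately have w3: "B v w3 = 1" "B x w3 = 0" "w3 \<in> W" "B w3 w3 = 0"
      using w2 v(1) by (simp_all add: w3_def B_diff B_sc B_sc_left subW Bvv Bxv Bw2)
    have Bw3: "B w3 v = 1" "B w3 x = 0"
      using w3 B_cnj[of v w3] B_cnj[of x w3] by auto
    \<comment> \<open>This is the part of \<open>g w3\<close> still to be determined; being
      orthogonal to \<open>v\<close> and \<open>x\<close>, it is a multiple of
      \<open>v\<close>.\<close>
    define d where "d = g w3 - w3 \<star> lq + x \<star> (K * lq)"
    have "B x d = 0"
    proof -
      have "B (g x) (g w3) = q_cnj lq * (B x (g w3) + K * B v (g w3))"
        unfolding x(3) by (simp only: B_sc_left B_add_left K flip: K_def)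
      then have "B x (g w3) + K * B v (g w3) = 0"
        using w3(2) lq0 by auto
      then show ?thesis
        using x(4) by (auto simp: d_def B_add B_diff B_sc w3 Bvg K_def simp flip: Qz_0)
    qed
    moreover have "B v d = 0"
      by (simp add: d_def B_add B_diff B_sc w3 Bvg x(2))
    moreover have "d \<in> W"
      using w3(3) x(1) gW by (auto simp: d_def intro!: subW)
    ultimately obtain q where q: "d = v \<star> q"
      using x(5) by blast
    define \<sigma> where "\<sigma> = q * q_cnj lq"
    have "\<sigma> * lq = q"
      by (simp add: \<sigma>_def mult.assoc li)
    then have "g w3 - w3 \<star> lq + x \<star> (K * lq) = v \<star> \<sigma> \<star> lq"
      using q by (simp add: d_def)
    then have gw3: "g w3 = (w3 - x \<star> K + v \<star> \<sigma>) \<star> lq"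
      by (simp add: sc_add sc_diff algebra_simps)
    \<comment> \<open>Nullity of \<open>g w3\<close> fixes the real part of \<open>\<sigma>\<close>,
      so that \<open>\<sigma> + H\<close> is imaginary.\<close>
    have "B (g w3) (g w3) = q_cnj lq * ((K * (B x x * K) + \<sigma> + q_cnj \<sigma>) * lq)"
      unfolding gw3 by (simp add: B_add B_add_left B_diff B_sc B_sc_left w3 Bw3 Bvv Bxv x(2) K algebra_simps)
    then have "K * (B x x * K) + \<sigma> + q_cnj \<sigma> = 0"
      using w3(4) lq0 by auto
    moreover have "K * (B x x * K) = H + H"
      using x(4) HH by (auto simp: K_def simp flip: Qz_0)
    ultimately have imag: "q_cnj (\<sigma> + H) = - (\<sigma> + H)"
      by (simp add: H eq_neg_iff_add_eq_0 algebra_simps)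
    \<comment> \<open>Replacing \<open>w3\<close> by \<open>w3 + v \<star> c\<close> adds
      \<open>lq * c * q_cnj lq - c\<close> to \<open>\<sigma>\<close> and keeps the vector null as
      \<open>c\<close> is imaginary. This freedom makes the parameter \<open>t\<close> commute with
      \<open>lq\<close>.\<close>
    obtain c p where c: "q_cnj c = - c" and p: "p * p = -1" "q_cnj p = - p" "p * lq = q_cnj lq * p"
      "p * (\<sigma> + H + lq * c * q_cnj lq - c) = - (\<sigma> + H + lq * c * q_cnj lq - c) * p"
      "(\<sigma> + H + lq * c * q_cnj lq - c) * lq = lq * (\<sigma> + H + lq * c * q_cnj lq - c)"
      unfolding lq_def by (rule ex_commuting_imaginary[OF True imag])
    define t where "t = \<sigma> + H + lq * c * q_cnj lq - c"
    define w where "w = w3 + v \<star> c"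
    have tc: "q_cnj t = - t"
      using imag c by (simp add: t_def mult.assoc)
    have "(t - H) * lq = \<sigma> * lq + lq * c - c * lq"
      by (simp add: t_def algebra_simps mult.assoc li)
    then have gw: "g w = (w - x \<star> K + v \<star> (t - H)) \<star> lq"
      by (simp add: w_def g_add g_sc gw3 gv sc_add sc_diff)
        (simp add: sc_add_right sc_diff_right)
    have w: "w \<in> W" "B w w = 0" "B v w = 1" "B w x = 0"
      using w3 v(1) by (auto simp: w_def B_add B_add_left B_sc B_sc_left Bvv Bw3 c x(2) intro!: subW)
    obtain P a where Pa: "reversing_pair P a" "P v = v"
      "\<And>y. \<exists>q r s. P y = v \<star> q + w \<star> r + x \<star> s" "\<And>y. \<exists>q r s. a y = v \<star> q + w \<star> r + x \<star> s"
      using reversing_pair_parabolic[OF gv x(3) gw[unfolded K_def H_def] l1 Bvv w(2,3) x(2) w(4) x(4)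
          tc p(5)[folded t_def] p(1-3) p(4)[folded t_def]] by blast
    show ?thesis
    proof (rule reversible_on_split[OF Pa(1) W(1-3) _ _ v(1,2) Pa(2) step])
      show "P y \<in> W" "a y \<in> W" for y
        using Pa(3)[of y] Pa(4)[of y] v(1) w(1) x(1) by (auto intro!: subW)
    qed
  qed
qed

lemma reversible_on_lorentzian:
  assumes "inv_subsp W" "nondegenerate W" "dim_le W m" "W \<subseteq> V"
  shows "reversible_on W"
  using assms
proof (induction m arbitrary: W)
  case 0
  then have "x = 0" if "x \<in> W" for x
    using dim_le_0 that by blast
  then show ?case
    unfolding reversible_on_def
    by (intro exI[of _ id]) (auto simp: lin_def, (metis g_0 add.inverse_neutral)+)
next
  case (Suc m)
  show ?case
  proof (cases "\<exists>w\<in>W. w \<noteq> 0")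
    case True
    then obtain w where "w \<in> W" "w \<noteq> 0"
      by blast
    then show ?thesis
      using Suc by (intro reversible_on_step[of W m w]) auto
  next
    case False
    then have "dim_le W m"
      using Suc.prems(3) unfolding dim_le_def by blast
    with Suc show ?thesis
      by blast
  qed
qed

end


section \<open>The group Sp(n,1)\<close>

definition vsc :: "(nat \<Rightarrow> quat) \<Rightarrow> quat \<Rightarrow> nat \<Rightarrow> quat" where
  "vsc x q = (\<lambda>i. x i * q)"

definition inner :: "nat \<Rightarrow> (nat \<Rightarrow> quat) \<Rightarrow> (nat \<Rightarrow> quat) \<Rightarrow> quat" where
  "inner n x y = (\<Sum>i\<le>n. q_cnj (x i) * y i)"

text \<open>A matrix acts on the first \<open>n + 1\<close> coordinates and fixes the others; this keeps the action of
  an invertible matrix bijective on all functions.\<close>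
definition mact :: "nat \<Rightarrow> quat mat \<Rightarrow> (nat \<Rightarrow> quat) \<Rightarrow> nat \<Rightarrow> quat" where
  "mact n A x = (\<lambda>i. if i \<le> n then \<Sum>j\<le>n. A $$ (i, j) * x j else x i)"

definition form :: "nat \<Rightarrow> (nat \<Rightarrow> quat) \<Rightarrow> (nat \<Rightarrow> quat) \<Rightarrow> quat" where
  "form n x y = inner n x (mact n (J_mat n) y)"

text \<open>The columns of length \<open>n + 1\<close>, as a subspace of a type that does not depend
  on \<open>n\<close>; the form ignores all later coordinates.\<close>

definition fin_supp :: "nat \<Rightarrow> (nat \<Rightarrow> quat) set" where
  "fin_supp n = {x. \<forall>i>n. x i = 0}"

definition unit_fun :: "nat \<Rightarrow> nat \<Rightarrow> quat" where
  "unit_fun j = (\<lambda>i. if i = j then 1 else 0)"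

abbreviation sq_mat :: "nat \<Rightarrow> quat mat set" where
  "sq_mat n \<equiv> carrier_mat (n + 1) (n + 1)"

lemma mat_mult_entry:
  assumes "A \<in> sq_mat n" "B \<in> sq_mat n" "i \<le> n" "j \<le> n"
  shows "(A * B) $$ (i, j) = (\<Sum>k\<le>n. A $$ (i, k) * B $$ (k, j))"
proof -
  have "{0..<Suc n} = {..n}"
    by auto
  with assms show ?thesis
    by (auto simp: scalar_prod_def simp del: sum.op_ivl_Suc intro!: sum.cong)
qed

lemma mact_mult:
  assumes "A \<in> sq_mat n" "B \<in> sq_mat n"
  shows "mact n (A * B) x = mact n A (mact n B x)"
proof
  fix i
  show "mact n (A * B) x i = mact n A (mact n B x) i"
  proof (cases "i \<le> n")
    case True
    have "(A * B) $$ (i, j) * x j = (\<Sum>k\<le>n. A $$ (i, k) * (B $$ (k, j) * x j))" if "j \<le> n" for j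
      using mat_mult_entry[OF assms True that] by (simp only: sum_distrib_right mult.assoc)
    then have "mact n (A * B) x i = (\<Sum>j\<le>n. \<Sum>k\<le>n. A $$ (i, k) * (B $$ (k, j) * x j))"
      using True by (simp only: mact_def if_True) (intro sum.cong, auto)
    also have "\<dots> = (\<Sum>k\<le>n. A $$ (i, k) * (\<Sum>j\<le>n. B $$ (k, j) * x j))"
      by (subst sum.swap) (simp add: sum_distrib_left)
    finally show ?thesis
      using True by (simp add: mact_def)
  qed (simp add: mact_def)
qed

lemma mact_one: "mact n (1\<^sub>m (n + 1)) x = x"
proof
  fix i
  show "mact n (1\<^sub>m (n + 1)) x i = x i"
  proof (cases "i \<le> n")
    case True
    have "1\<^sub>m (n + 1) $$ (i, j) * x j = (if i = j then x j else 0)" if "j \<le> n" for j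
      using True that by simp
    with True show ?thesis
      by (simp add: mact_def del: index_one_mat)
  qed (simp add: mact_def)
qed

lemma mact_add: "mact n A (x + y) = mact n A x + mact n A y"
  by (rule ext) (auto simp: mact_def distrib_left sum.distrib)

lemma mact_sc: "mact n A (vsc x q) = vsc (mact n A x) q"
  by (rule ext) (auto simp: mact_def vsc_def sum_distrib_right mult.assoc)

lemma mact_in: "x \<in> fin_supp n \<Longrightarrow> mact n A x \<in> fin_supp n"
  by (simp add: fin_supp_def mact_def)

lemma unit_fun_in: "j \<le> n \<Longrightarrow> unit_fun j \<in> fin_supp n"
  by (simp add: fin_supp_def unit_fun_def)

lemma mact_unit_fun: "i \<le> n \<Longrightarrow> j \<le> n \<Longrightarrow> mact n A (unit_fun j) i = A $$ (i, j)"
  by (simp add: mact_def unit_fun_def if_distrib cong: if_cong)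

lemma inner_unit_fun: "i \<le> n \<Longrightarrow> inner n (unit_fun i) x = x i"
proof -
  have "q_cnj (if j = i then 1 else 0) * x j = (if j = i then x j else 0)" for j
    by auto
  then show "i \<le> n \<Longrightarrow> inner n (unit_fun i) x = x i"
    by (simp add: inner_def unit_fun_def)
qed

lemma mat_eqI_mact:
  assumes "A \<in> sq_mat n" "B \<in> sq_mat n" "\<And>x. x \<in> fin_supp n \<Longrightarrow> mact n A x = mact n B x"
  shows "A = B"
proof (rule eq_matI)
  fix i j assume "i < dim_row B" "j < dim_col B"
  then have "i \<le> n" "j \<le> n"
    using assms(2) by auto
  then show "A $$ (i, j) = B $$ (i, j)"
    using assms(3)[OF unit_fun_in[of j n]] mact_unit_fun[of i n j] by metis
qed (use assms in auto)

lemma inner_mact: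
  assumes "A \<in> sq_mat n"
  shows "inner n (mact n A x) y = inner n x (mact n (q_adjoint A) y)"
proof -
  have "inner n (mact n A x) y = (\<Sum>i\<le>n. \<Sum>j\<le>n. q_cnj (x j) * (q_cnj (A $$ (i, j)) * y i))"
    by (simp add: inner_def mact_def q_cnj_sum sum_distrib_right mult.assoc)
  also have "\<dots> = (\<Sum>j\<le>n. q_cnj (x j) * (\<Sum>i\<le>n. q_cnj (A $$ (i, j)) * y i))"
    by (subst sum.swap) (simp add: sum_distrib_left)
  also have "\<dots> = inner n x (mact n (q_adjoint A) y)"
    using assms by (auto simp: inner_def mact_def q_adjoint_def intro!: sum.cong)
  finally show ?thesis .
qed

section \<open>The Hermitian form of signature (n,1)\<close>

lemma form_eq: "form n x y = (\<Sum>i\<le>n. q_cnj (x i) * ((if i = 0 then - 1 else 1) * y i))"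
proof -
  have "(\<Sum>j\<le>n. J_mat n $$ (i, j) * y j) = (if i = 0 then - 1 else 1) * y i" if "i \<le> n" for i
  proof -
    have "J_mat n $$ (i, j) * y j = (if i = j then (if j = 0 then - 1 else 1) * y j else 0)"
      if "j \<le> n" for j
      using \<open>i \<le> n\<close> that by (simp add: J_mat_def mat_diag_def)
    with that show ?thesis
      by simp
  qed
  then show ?thesis
    by (auto simp: form_def inner_def mact_def intro!: sum.cong)
qed

lemma form_mact:
  assumes "A \<in> sq_mat n"
  shows "form n (mact n A x) (mact n A y) = inner n x (mact n (q_adjoint A * J_mat n * A) y)"
proof -
  have J: "J_mat n \<in> sq_mat n"
    by (rule J_mat_carrier)
  have A': "q_adjoint A \<in> sq_mat n"
    using assms by (rule q_adjoint_carrier)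
  show ?thesis
    unfolding form_def inner_mact[OF assms] mact_mult[OF mult_carrier_mat[OF A' J] assms]
      mact_mult[OF A' J] ..
qed

lemma form_unit_fun: "i \<le> n \<Longrightarrow> form n x (unit_fun i) = (if i = 0 then - q_cnj (x i) else q_cnj (x i))"
proof -
  assume "i \<le> n"
  have "form n x (unit_fun i) = (\<Sum>j\<le>n. if i = j then (if j = 0 then - q_cnj (x j) else q_cnj (x j)) else 0)"
    unfolding form_eq by (rule sum.cong) (auto simp: unit_fun_def)
  with \<open>i \<le> n\<close> show ?thesis
    by simp
qed

lemma q_re_form_self: "q_re (form n x x) = - q_norm2 (x 0) + (\<Sum>i\<in>{1..n}. q_norm2 (x i))"
proof -
  have "{..n} = insert 0 {1..n}"
    by auto
  then have "form n x x = - q_real (q_norm2 (x 0)) + (\<Sum>i\<in>{1..n}. q_real (q_norm2 (x i)))"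
    by (auto simp: form_eq q_cnj_mult_self intro!: sum.cong)
  moreover have "q_re (p + q) = q_re p + q_re q" "q_re (p - q) = q_re p - q_re q" for p q
    by (auto simp: plus_quat_def minus_quat_def)
  moreover have "q_re (\<Sum>i\<in>{1..n}. f i) = (\<Sum>i\<in>{1..n}. q_re (f i))" for f
    by (induction n) (auto simp: plus_quat_def zero_quat_def)
  ultimately show ?thesis
    by simp
qed

lemma fin_supp_eq_0I:
  assumes "x \<in> fin_supp n" "x 0 = 0" "(\<Sum>i\<in>{1..n}. q_norm2 (x i)) = 0"
  shows "x = 0"
proof
  fix i
  have "\<forall>i\<in>{1..n}. q_norm2 (x i) = 0"
    using assms(3) by (subst (asm) sum_nonneg_eq_0_iff) auto
  then show "x i = 0 i"
    using assms by (cases "i = 0"; cases "i \<le> n") (auto simp: fin_supp_def)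
qed

lemma quat_isometry_mact:
  assumes "A \<in> sq_mat n" "A' \<in> sq_mat n" "A * A' = 1\<^sub>m (n + 1)" "A' * A = 1\<^sub>m (n + 1)"
    "q_adjoint A * J_mat n * A = J_mat n"
  shows "quat_isometry vsc (form n) (mact n A) (mact n A')"
proof
  show "mact n A (mact n A' x) = x" "mact n A' (mact n A x) = x" for x
    by (metis assms mact_mult mact_one)+
  show "form n (mact n A x) (mact n A y) = form n x y" for x y
    unfolding form_mact[OF assms(1)] assms(5) by (simp only: form_def)
  show "q_cnj (form n x y) = form n y x" for x y
    unfolding form_eq q_cnj_sum by (intro sum.cong) auto
  show "form n x (y + z) = form n x y + form n x z" for x y z
    by (simp add: form_eq algebra_simps sum.distrib)
  show "form n x (vsc y q) = form n x y * q" for x y q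
    unfolding form_eq vsc_def sum_distrib_right mult.assoc ..
qed (auto simp: vsc_def algebra_simps mact_add mact_sc[unfolded vsc_def])

text \<open>On columns with vanishing coordinate 0 the form is positive definite, so a nonzero null
  \<open>v\<close> has \<open>v 0 \<noteq> 0\<close>. Subtracting a multiple of \<open>v\<close>
  makes coordinate 0 of \<open>x\<close> vanish without changing \<open>form n x x\<close>.\<close>

lemma lorentz_isometry_mact:
  assumes "A \<in> sq_mat n" "A' \<in> sq_mat n" "A * A' = 1\<^sub>m (n + 1)" "A' * A = 1\<^sub>m (n + 1)"
    "q_adjoint A * J_mat n * A = J_mat n"
  shows "lorentz_isometry vsc (form n) (mact n A) (mact n A') (fin_supp n)"
proof -
  interpret quat_isometry vsc "form n" "mact n A" "mact n A'"
    using assms by (rule quat_isometry_mact)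
  show ?thesis
  proof
    fix v x assume v: "v \<in> fin_supp n" "v \<noteq> 0" "form n v v = 0" "form n v x = 0" and x: "x \<in> fin_supp n"
    have "v 0 \<noteq> 0"
    proof
      assume "v 0 = 0"
      moreover have "q_re (form n v v) = 0"
        by (simp add: v(3) zero_quat_def)
      ultimately show False
        using fin_supp_eq_0I[OF v(1)] v(2) by (simp add: q_re_form_self zero_quat_def q_norm2_def)
    qed
    define y where "y = x - vsc v (inverse (v 0) * x 0)"
    have y0: "y 0 = 0"
      using \<open>v 0 \<noteq> 0\<close> by (simp add: y_def vsc_def flip: mult.assoc)
    have y: "y \<in> fin_supp n"
      using v(1) x by (simp add: fin_supp_def y_def vsc_def)
    have "form n x v = 0"
      using v(4) B_eq_0_commute by blast
    then have "form n x x = form n y y"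
      by (simp add: y_def B_diff B_sc B_sc_left v)
    then have re: "q_re (form n x x) = (\<Sum>i\<in>{1..n}. q_norm2 (y i))"
      by (simp add: q_re_form_self[of n y] y0)
    show "0 < q_re (form n x x) \<or> (\<exists>q. x = vsc v q)"
    proof (cases "(\<Sum>i\<in>{1..n}. q_norm2 (y i)) = 0")
      case True
      then have "x = vsc v (inverse (v 0) * x 0)"
        using fin_supp_eq_0I[OF y y0] unfolding y_def right_minus_eq by blast
      then show ?thesis
        by blast
    next
      case False
      then show ?thesis
        unfolding re by (simp add: order.not_eq_order_implies_strict sum_nonneg)
    qed
  qed
qed

section \<open>From linear maps back to matrices and cosets\<close>

lemma linear_fun_eq_mact:
  assumes add: "\<And>x y. f (x + y) = f x + f y" and sc: "\<And>x q. f (vsc x q) = vsc (f x) q"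
    and f: "\<And>x. x \<in> fin_supp n \<Longrightarrow> f x \<in> fin_supp n"
  defines "A \<equiv> mat (n + 1) (n + 1) (\<lambda>(i, j). f (unit_fun j) i)"
  assumes x: "x \<in> fin_supp n"
  shows "mact n A x = f x"
proof
  fix i
  have "f 0 = f 0 + f 0"
    using add[of 0 0] by simp
  then have f0: "f 0 = 0"
    by simp
  have x_sum: "x = (\<Sum>j\<le>n. vsc (unit_fun j) (x j))"
  proof
    fix i
    have "(\<Sum>j\<in>S. vsc (unit_fun j) (x j)) i = (\<Sum>j\<in>S. if i = j then x j else 0)" for S
      by (induction S rule: infinite_finite_induct) (auto simp: vsc_def unit_fun_def)
    then show "x i = (\<Sum>j\<le>n. vsc (unit_fun j) (x j)) i"
      using x by (simp add: fin_supp_def)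
  qed
  have "f (\<Sum>j\<in>S. vsc (unit_fun j) (x j)) i = (\<Sum>j\<in>S. f (unit_fun j) i * x j)" for S
  proof (induction S rule: infinite_finite_induct)
    case (insert j S)
    have "f (\<Sum>j\<in>insert j S. vsc (unit_fun j) (x j)) = vsc (f (unit_fun j)) (x j) + f (\<Sum>j\<in>S. vsc (unit_fun j) (x j))"
      unfolding sum.insert[OF insert(1,2)] by (subst add) (simp only: sc)
    with insert show ?case
      by (simp only: plus_fun_apply sum.insert) (simp add: vsc_def)
  next
    case (infinite S)
    show ?case
      unfolding sum.infinite[OF infinite] f0 by simp
  next
    case empty
    show ?case
      unfolding sum.empty f0 by simp
  qed
  then have "f x i = (\<Sum>j\<le>n. f (unit_fun j) i * x j)"
    using arg_cong[OF x_sum, of "\<lambda>y. f y i"] by (rule trans[rotated])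
  moreover have "mact n A x i = (\<Sum>j\<le>n. f (unit_fun j) i * x j)" if "i \<le> n"
    using that by (auto simp: mact_def A_def intro!: sum.cong)
  moreover have "mact n A x i = f x i" if "\<not> i \<le> n"
    using that x f[OF x] by (simp add: mact_def fin_supp_def)
  ultimately show "mact n A x i = f x i"
    by (cases "i \<le> n") (simp_all only: not_True_eq_False not_False_eq_True)
qed

text \<open>The space of all columns is nondegenerate and its \<open>n + 1\<close> coordinates
  separate points, so it carries a reversing map; \<open>A\<close> is the matrix of this map, and
  each required identity is checked on columns.\<close>

lemma ex_reversing_matrix:
  assumes G: "G \<in> carrier (Sp n)"
  obtains A where "A \<in> carrier (Sp n)" "A * A = - 1\<^sub>m (n + 1)" "(A * G) * (A * G) = - 1\<^sub>m (n + 1)"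
proof -
  from G obtain G' where G': "G \<in> sq_mat n" "G' \<in> sq_mat n" "G * G' = 1\<^sub>m (n + 1)" "G' * G = 1\<^sub>m (n + 1)"
    "q_adjoint G * J_mat n * G = J_mat n"
    unfolding Sp_carrier_iff by blast
  interpret lorentz_isometry vsc "form n" "mact n G" "mact n G'" "fin_supp n"
    using G' by (rule lorentz_isometry_mact)
  have "subsp (fin_supp n)"
    by (auto simp: subsp_def fin_supp_def vsc_def)
  then have inv: "inv_subsp (fin_supp n)"
    by (auto simp: inv_subsp_def mact_in)
  have nondeg: "nondegenerate (fin_supp n)"
    unfolding nondegenerate_def
  proof (intro ballI impI ext)
    fix x i assume x: "x \<in> fin_supp n" "\<forall>y\<in>fin_supp n. form n x y = 0"
    show "x i = 0 i"
    proof (cases "i \<le> n")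
      case True
      then have "form n x (unit_fun i) = 0"
        using x(2) unit_fun_in by blast
      with True show ?thesis
        by (simp add: form_unit_fun split: if_splits)
    qed (use x in \<open>simp add: fin_supp_def\<close>)
  qed
  have dim: "dim_le (fin_supp n) (n + 1)"
    unfolding dim_le_def
  proof (intro exI[of _ "\<lambda>i x. x i"] conjI allI ballI impI)
    show "functional (\<lambda>x. x i)" for i
      by (simp add: functional_def vsc_def)
    fix x assume x: "x \<in> fin_supp n" "\<forall>i<n + 1. x i = 0"
    show "x = 0"
    proof
      fix i
      show "x i = 0 i"
        using x by (cases "i \<le> n") (auto simp: fin_supp_def)
    qed
  qed
  obtain f where f: "\<And>x y. f (x + y) = f x + f y" "\<And>x q. f (vsc x q) = vsc (f x) q"
    "\<And>x. x \<in> fin_supp n \<Longrightarrow> f x \<in> fin_supp n" "\<And>x. x \<in> fin_supp n \<Longrightarrow> f (f x) = - x"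
    "\<And>x. x \<in> fin_supp n \<Longrightarrow> f (mact n G (f (mact n G x))) = - x"
    "\<And>x y. x \<in> fin_supp n \<Longrightarrow> y \<in> fin_supp n \<Longrightarrow> form n (f x) (f y) = form n x y"
    using reversible_on_lorentzian[OF inv nondeg dim order_refl] unfolding reversible_on_def lin_def
    by blast
  define A where "A = mat (n + 1) (n + 1) (\<lambda>(i, j). f (unit_fun j) i)"
  have A: "A \<in> sq_mat n"
    by (simp add: A_def)
  have Af: "mact n A x = f x" if "x \<in> fin_supp n" for x
    unfolding A_def using f(1-3) that by (rule linear_fun_eq_mact)
  have I: "- 1\<^sub>m (n + 1) \<in> sq_mat n"
    by simp
  have mI: "mact n (- 1\<^sub>m (n + 1)) x = - x" if "x \<in> fin_supp n" for x
  proof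
    fix i
    have "(- 1\<^sub>m (n + 1)) $$ (i, j) * x j = (if i = j then - x j else 0)" if "i \<le> n" "j \<le> n" for j
      using that by simp
    with that show "mact n (- 1\<^sub>m (n + 1)) x i = (- x) i"
      by (simp add: mact_def fin_supp_def del: index_uminus_mat index_one_mat)
  qed
  have AA: "A * A = - 1\<^sub>m (n + 1)"
  proof (rule mat_eqI_mact[OF mult_carrier_mat[OF A A] I])
    fix x assume x: "x \<in> fin_supp n"
    show "mact n (A * A) x = mact n (- 1\<^sub>m (n + 1)) x"
      unfolding mact_mult[OF A A] Af[OF x] Af[OF f(3)[OF x]] f(4)[OF x] mI[OF x] ..
  qed
  note AG = mult_carrier_mat[OF A G'(1)]
  have "(A * G) * (A * G) = - 1\<^sub>m (n + 1)"
  proof (rule mat_eqI_mact[OF mult_carrier_mat[OF AG AG] I])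
    fix x assume x: "x \<in> fin_supp n"
    note Gx = mact_in[OF x, of G]
    show "mact n (A * G * (A * G)) x = mact n (- 1\<^sub>m (n + 1)) x"
      unfolding mact_mult[OF AG AG] mact_mult[OF A G'(1)] Af[OF Gx] Af[OF mact_in[OF f(3)[OF Gx]]]
        f(5)[OF x] mI[OF x] ..
  qed
  moreover have "q_adjoint A * J_mat n * A = J_mat n"
  proof (rule eq_matI)
    fix i j assume "i < dim_row (J_mat n)" "j < dim_col (J_mat n)"
    then have ij: "i \<le> n" "j \<le> n"
      using J_mat_carrier[of n] by auto
    have "(q_adjoint A * J_mat n * A) $$ (i, j) = inner n (unit_fun i) (mact n (q_adjoint A * J_mat n * A) (unit_fun j))"
      using ij by (simp add: inner_unit_fun mact_unit_fun)
    also have "\<dots> = form n (unit_fun i) (unit_fun j)"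
      using ij by (simp only: f(6) Af unit_fun_in flip: form_mact[OF A])
    also have "\<dots> = J_mat n $$ (i, j)"
      using ij by (simp add: form_def inner_unit_fun mact_unit_fun)
    finally show "(q_adjoint A * J_mat n * A) $$ (i, j) = J_mat n $$ (i, j)" .
  qed (use A J_mat_carrier[of n] in \<open>auto simp: q_adjoint_def\<close>)
  \<comment> \<open>Membership in \<open>Sp n\<close> asks for a two-sided inverse, which is
    \<open>- A\<close> because \<open>A * A\<close> is -1.\<close>
  moreover have "A * - A = 1\<^sub>m (n + 1)" "- A * A = 1\<^sub>m (n + 1)"
    using A AA by (simp_all add: uminus_mult_left_mat uminus_mult_right_mat)
  ultimately show ?thesis
    using A AA by (intro that[of A]) (auto simp: Sp_carrier_iff intro!: bexI[of _ "- A"])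
qed

text \<open>The square of \<open>a\<close> becomes trivial in the quotient, whereas \<open>a\<close>
  does not: 1 and -1 both have square 1, which differs from -1.\<close>

lemma involution_coset:
  assumes a: "a \<in> carrier (Sp n)" and aa: "a * a = - 1\<^sub>m (n + 1)"
  shows "involution_in (PSp n) ({1\<^sub>m (n + 1), - 1\<^sub>m (n + 1)} #>\<^bsub>Sp n\<^esub> a)"
proof -
  let ?N = "{1\<^sub>m (n + 1), - 1\<^sub>m (n + 1)} :: quat mat set"
  interpret normal ?N "Sp n"
    by (rule normal_pm_one_Sp)
  have "(?N #>\<^bsub>Sp n\<^esub> a) <#>\<^bsub>Sp n\<^esub> (?N #>\<^bsub>Sp n\<^esub> a) = ?N #>\<^bsub>Sp n\<^esub> (a \<otimes>\<^bsub>Sp n\<^esub> a)"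
    by (rule rcos_sum[OF a a])
  also have "\<dots> = ?N"
  proof (rule coset_join2[OF m_closed[OF a a] subgroup_axioms])
    show "a \<otimes>\<^bsub>Sp n\<^esub> a \<in> ?N"
      unfolding Sp_mult aa by blast
  qed
  finally have sq: "(?N #>\<^bsub>Sp n\<^esub> a) <#>\<^bsub>Sp n\<^esub> (?N #>\<^bsub>Sp n\<^esub> a) = ?N" .
  have ne: "(1\<^sub>m (n + 1) :: quat mat) \<noteq> - 1\<^sub>m (n + 1)"
  proof
    assume "(1\<^sub>m (n + 1) :: quat mat) = - 1\<^sub>m (n + 1)"
    then have "(1\<^sub>m (n + 1) :: quat mat) $$ (0, 0) = (- 1\<^sub>m (n + 1)) $$ (0, 0)"
      by simp
    then show False
      by (simp add: quat_eq_iff one_quat_def uminus_quat_def)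
  qed
  have "- 1\<^sub>m (n + 1) * - 1\<^sub>m (n + 1) = (1\<^sub>m (n + 1) :: quat mat)"
    by (simp add: uminus_mult_left_mat uminus_mult_right_mat)
  then have "x * x = 1\<^sub>m (n + 1)" if "x \<in> ?N" for x
    using that left_mult_one_mat[OF one_carrier_mat] by (elim insertE emptyE) (simp_all only:)
  then have "a \<notin> ?N"
    using aa ne by metis
  then have "?N #>\<^bsub>Sp n\<^esub> a \<noteq> ?N"
    using rcos_self[OF a subgroup_axioms] by metis
  moreover have "?N #>\<^bsub>Sp n\<^esub> a \<in> rcosets\<^bsub>Sp n\<^esub> ?N"
    using rcosetsI[OF subset a] .
  ultimately show ?thesis
    using sq unfolding involution_in_def PSp_def FactGroup_def by simp
qed

theorem theorem1p5:
  fixes n :: nat and g :: "quat mat set"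
  assumes "n \<ge> 1" and "g \<in> carrier (PSp n)"
  shows "\<exists>a b. involution_in (PSp n) a \<and> involution_in (PSp n) b \<and> g = a \<otimes>\<^bsub>PSp n\<^esub> b"
proof -
  let ?N = "{1\<^sub>m (n + 1), - 1\<^sub>m (n + 1)} :: quat mat set"
  interpret normal ?N "Sp n"
    by (rule normal_pm_one_Sp)
  obtain G where G: "G \<in> carrier (Sp n)" "g = ?N #>\<^bsub>Sp n\<^esub> G"
    using assms(2) unfolding PSp_def FactGroup_def RCOSETS_def partial_object.simps by blast
  obtain A where A: "A \<in> carrier (Sp n)" "A * A = - 1\<^sub>m (n + 1)" "(A * G) * (A * G) = - 1\<^sub>m (n + 1)"
    using G(1) by (rule ex_reversing_matrix)
  have AG: "A * G \<in> carrier (Sp n)"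
    using m_closed[OF A(1) G(1)] by simp
  \<comment> \<open>The product \<open>A * (A * G)\<close> is \<open>- G\<close>, which lies in the
    coset of \<open>G\<close>, and both factors square to -1.\<close>
  have "(?N #>\<^bsub>Sp n\<^esub> A) <#>\<^bsub>Sp n\<^esub> (?N #>\<^bsub>Sp n\<^esub> (A * G)) = ?N #>\<^bsub>Sp n\<^esub> (A * (A * G))"
    using rcos_sum[OF A(1) AG] by simp
  also have "A * (A * G) = (A * A) * G"
    using m_assoc[OF A(1) A(1) G(1)] by simp
  also have "\<dots> = (A * A) \<otimes>\<^bsub>Sp n\<^esub> G"
    by simp
  also have "?N #>\<^bsub>Sp n\<^esub> ((A * A) \<otimes>\<^bsub>Sp n\<^esub> G) = (?N #>\<^bsub>Sp n\<^esub> (A * A)) #>\<^bsub>Sp n\<^esub> G"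
    using m_closed[OF A(1) A(1)] unfolding Sp_mult
    by (rule coset_mult_assoc[OF subset _ G(1), unfolded Sp_mult, symmetric])
  also have "?N #>\<^bsub>Sp n\<^esub> (A * A) = ?N"
  proof (rule coset_join2[OF _ subgroup_axioms])
    show "A * A \<in> carrier (Sp n)"
      using m_closed[OF A(1) A(1)] unfolding Sp_mult .
    show "A * A \<in> ?N"
      unfolding A(2) by blast
  qed
  finally have "g = (?N #>\<^bsub>Sp n\<^esub> A) \<otimes>\<^bsub>PSp n\<^esub> (?N #>\<^bsub>Sp n\<^esub> (A * G))"
    by (simp add: PSp_def FactGroup_def G(2))
  then show ?thesis
    using involution_coset[OF A(1,2)] involution_coset[OF AG A(3)] by blast
qed


end
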